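(* Let $m\ge2$ be an integer and $l$ an integer with $l\ge s(m)e^{s(m)}$. Then $D_{m,l}\ge e^{\kappa_m ml}$. Further, \[ \kappa_m\ge w_{\frac{m+1}{2}}\!\left(s(m)e^{s(m)}\right)\frac1m\sum_{\substack{p\le\frac{m+1}{2}\\ p\text{ prime}}}\left(\left\lfloor\frac{m+1}{p}\right\rfloor-1\right)\frac{\log p}{p-1}, \] and \[ \lim_{m\to\infty}\kappa_m=\kappa=\sum_{p\text{ prime}}\frac{\log p}{p(p-1)}=0.75536661083\dots. \]
   Context: $v_p$ is the $p$-adic valuation. $s(2)=e$, $s(m)=m(\log m)^2$ for $m\ge3$. For real $y>1$, $x>1$, $w_y(x)=1-\frac yx-\frac{y-1}{\log y}\frac{\log x}{x}$. $D_{m,l}=\prod_{p\le (m+1)/2,\ p\text{ prime}}p^{\mu_p v_p((l-1)!)}$ with $\mu_p=\min_{0\le j\le m}(\lfloor j/p\rfloor+\lfloor (m-j)/p\rfloor)$, and $\kappa_m=\frac1m\sum_{p\le (m+1)/2,\ p\text{ prime}}\mu_p\frac{\log p}{p-1}w_p(s(m)e^{s(m)})$. *)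

theory Defs
  imports "HOL-Analysis.Analysis" "HOL-Computational_Algebra.Primes"
begin

definition s_fun :: "nat \<Rightarrow> real" where
  "s_fun m = (if m = 2 then exp 1 else real m * (ln (real m))\<^sup>2)"

definition w_fun :: "real \<Rightarrow> real \<Rightarrow> real" where
  "w_fun y x = 1 - y / x - (y - 1) / ln y * (ln x / x)"

definition small_primes :: "nat \<Rightarrow> nat set" where
  "small_primes m = {p. prime p \<and> real p \<le> (real m + 1) / 2}"

definition mu :: "nat \<Rightarrow> nat \<Rightarrow> nat" where
  "mu m p = Min ((\<lambda>j. j div p + (m - j) div p) ` {0..m})"

definition D :: "nat \<Rightarrow> nat \<Rightarrow> nat" where
  "D m l = (\<Prod>p\<in>small_primes m. p ^ (mu m p * multiplicity p (fact (l - 1) :: nat)))"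

definition kappa_m :: "nat \<Rightarrow> real" where
  "kappa_m m = (1 / real m) * (\<Sum>p\<in>small_primes m.
      real (mu m p) * (ln (real p) / (real p - 1)) *
      w_fun (real p) (s_fun m * exp (s_fun m)))"

definition kappa :: real where
  "kappa = (\<Sum>\<^sub>\<infinity>p\<in>{p::nat. prime p}. ln (real p) / (real p * (real p - 1)))"

end

theory Submission
  imports Defs "HOL-Real_Asymp.Real_Asymp" "HOL-Number_Theory.Prime_Powers"
begin

text \<open>
  Legendre's recursion \<open>v\<^sub>p(n!) = \<lfloor>n/p\<rfloor> + v\<^sub>p(\<lfloor>n/p\<rfloor>!)\<close> gives
  \<open>n \<le> (p - 1) (v\<^sub>p(n!) + 1 + log\<^sub>p n)\<close>, that is, \<open>v\<^sub>p((l-1)!) \<ge> w\<^sub>p(l) l / (p - 1)\<close>, and \<open>w\<close> is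
  increasing in its second and decreasing in its first argument. Moreover
  \<open>\<mu>\<^sub>p = \<lfloor>(m+1)/p\<rfloor> - 1\<close>, with minimiser \<open>j = p - 1\<close>. The limit is dominated convergence.

  For the numerical value, put \<open>Z(k) = -\<zeta>'(k)/\<zeta>(k) = \<Sum>\<^sub>p ln p / (p^k - 1)\<close>. The expansion
  \<open>x^2/(1-x) = - \<Sum>\<^sub>k\<^sub>\<ge>\<^sub>2 moebius(k) x^k/(1-x^k)\<close> at \<open>x = 1/p\<close> shows that the summand
  \<open>ln p / (p (p - 1))\<close> agrees with that of \<open>Z(2) + Z(3) + Z(5) - Z(6) + Z(7)\<close> up to
  \<open>O(ln p / p^10)\<close>; the primes below 30 are corrected exactly. Both \<open>\<zeta>(k)\<close> and \<open>\<zeta>'(k)\<close> are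
  evaluated by Euler-Maclaurin summation starting at 30, whose terms are rational combinations of
  logarithms of primes below 30.
\<close>

section \<open>Factorials and the function w\<close>

text \<open>Going from n to n + 1 changes either side only when p divides n + 1. Then n + 1 = p * (n
  div p + 1), so both sides gain one plus the multiplicity of the new quotient.\<close>

lemma multiplicity_fact_div:
  fixes p :: nat
  assumes "prime p"
  shows "multiplicity p (fact n :: nat) = n div p + multiplicity p (fact (n div p) :: nat)"
proof (induction n)
  case (Suc n)
  have mult_Suc: "multiplicity p (fact (Suc k) :: nat) =
      multiplicity p (Suc k) + multiplicity p (fact k :: nat)" for k
    using assms by (simp add: prime_elem_multiplicity_mult_distrib del: mult_Suc)
  show ?case
  proof (cases "p dvd Suc n")
    case True
    have d: "Suc n div p = Suc (n div p)"
      using True by (simp add: div_Suc dvd_eq_mod_eq_0)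
    have e: "Suc n = p * Suc (n div p)" using True d by (metis dvd_mult_div_cancel)
    have "multiplicity p (Suc n) = multiplicity p p + multiplicity p (Suc (n div p))"
      using assms by (subst e, intro prime_elem_multiplicity_mult_distrib) auto
    then have "multiplicity p (Suc n) = Suc (multiplicity p (Suc (n div p)))"
      using assms by simp
    then show ?thesis using Suc mult_Suc[of n] mult_Suc[of "n div p"] d by simp
  next
    case False
    have "Suc n div p = n div p" using False by (simp add: div_Suc dvd_eq_mod_eq_0)
    moreover have "multiplicity p (Suc n) = 0" using False by (rule not_dvd_imp_multiplicity_0)
    ultimately show ?thesis using Suc mult_Suc[of n] by simp
  qed
qed simp

text \<open>By Legendre, n - (p - 1) v_p(n!) is the base-p digit sum of n, and n has at most 1 +
  log_p n digits, each at most p - 1. The induction passes from n to n div p, which removes one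
  digit and lowers the logarithm by at least 1.\<close>

lemma multiplicity_fact_lower:
  fixes p n :: nat
  assumes p: "prime p" and "n \<ge> 1"
  shows "real n \<le> (real p - 1) * (real (multiplicity p (fact n :: nat)) + 1 + log p n)"
  using \<open>n \<ge> 1\<close>
proof (induction n rule: less_induct)
  case (less n)
  have p1: "p > 1" using p prime_gt_1_nat by blast
  show ?case
  proof (cases "n < p")
    case True
    have "real n \<le> (real p - 1) * 1" using True by simp
    also have "\<dots> \<le> (real p - 1) * (real (multiplicity p (fact n :: nat)) + 1 + log p n)"
      using p1 less.prems by (intro mult_left_mono) auto
    finally show ?thesis .
  next
    case False
    define q where "q = n div p"
    have q: "q \<ge> 1" "q < n" using False p1 by (auto simp: q_def div_greater_zero_iff Suc_le_eq)
    have "n + 1 \<le> p * q + p" unfolding q_def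
      using p1 mod_less_divisor[of p n] mult_div_mod_eq[of p n] by linarith
    then have "real (n + 1) \<le> real (p * q + p)" by (rule of_nat_mono)
    then have n': "real n \<le> real p * real q + real p - 1" by simp
    have "p * q \<le> n" unfolding q_def by simp
    then have "log p (p * q) \<le> log p n" using p1 q by (subst log_le_cancel_iff) (auto simp flip: of_nat_mult)
    then have lg: "1 + log p q \<le> log p n" using p1 q by (simp add: log_mult)
    \<comment> \<open>p q + p - 1 is split so that a bare q remains, to which the induction
      hypothesis applies.\<close>
    have "real n \<le> (real p - 1) * (real q + 1) + real q" using n' by (simp add: algebra_simps)
    also have "\<dots> \<le> (real p - 1) * (real q + 1) +
        (real p - 1) * (real (multiplicity p (fact q :: nat)) + 1 + log p q)"
      using less.IH[OF q(2,1)] by simp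
    also have "\<dots> = (real p - 1) * (real q + real (multiplicity p (fact q :: nat)) + 1 + (1 + log p q))"
      by (simp add: algebra_simps)
    also have "\<dots> \<le> (real p - 1) * (real q + real (multiplicity p (fact q :: nat)) + 1 + log p n)"
      using lg p1 by (intro mult_left_mono) auto
    finally show ?thesis using multiplicity_fact_div[OF p, of n] by (simp add: q_def)
  qed
qed

lemma ln_div_self_antimono:
  fixes x y :: real
  assumes "exp 1 \<le> x" "x \<le> y"
  shows "ln y / y \<le> ln x / x"
proof (rule DERIV_nonpos_imp_nonincreasing[OF assms(2)])
  fix t assume t: "x \<le> t" "t \<le> y"
  have e: "exp 1 \<le> t" using t assms by simp
  have t0: "t > 0" using e exp_gt_zero[of 1] by linarith
  have "ln t \<ge> 1" using e t0 by (simp add: ln_ge_iff)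
  then have "(1 - ln t) / t\<^sup>2 \<le> 0" by (simp add: divide_nonpos_nonneg)
  moreover have "((\<lambda>t. ln t / t) has_real_derivative ((1 - ln t) / t\<^sup>2)) (at t)"
    using t0 by (auto intro!: derivative_eq_intros simp: power2_eq_square)
  ultimately show "\<exists>d. ((\<lambda>t. ln t / t) has_real_derivative d) (at t) \<and> d \<le> 0" by blast
qed

lemma w_fun_mono:
  assumes "y > 1" "exp 1 \<le> x" "x \<le> x'"
  shows "w_fun y x \<le> w_fun y x'"
proof -
  have x: "x > 0" using assms(2) exp_gt_zero[of "1::real"] by linarith
  have "y / x' \<le> y / x" using assms x by (intro divide_left_mono) auto
  moreover have "(y - 1) / ln y * (ln x' / x') \<le> (y - 1) / ln y * (ln x / x)"
    using assms by (intro mult_left_mono ln_div_self_antimono) auto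
  ultimately show ?thesis by (simp add: w_fun_def)
qed

lemma minus_one_div_ln_mono:
  fixes x y :: real
  assumes "1 < x" "x \<le> y"
  shows "(x - 1) / ln x \<le> (y - 1) / ln y"
proof (rule DERIV_nonneg_imp_nondecreasing[OF assms(2)])
  fix t assume t: "x \<le> t" "t \<le> y"
  have t0: "t > 1" using t assms by simp
  \<comment> \<open>The inequality ln z <= z - 1 at z = 1/t is exactly the nonnegativity of the
    numerator of the derivative.\<close>
  have "ln (1 / t) \<le> 1 / t - 1" using t0 by (intro ln_le_minus_one) auto
  then have "ln t - (t - 1) / t \<ge> 0" using t0 by (simp add: ln_div diff_divide_distrib)
  then have "(ln t - (t - 1) / t) / (ln t)\<^sup>2 \<ge> 0" by simp
  moreover have "((\<lambda>t. (t - 1) / ln t) has_real_derivative (ln t - (t - 1) / t) / (ln t)\<^sup>2) (at t)"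
    using t0 by (auto intro!: derivative_eq_intros simp: power2_eq_square)
  ultimately show "\<exists>d. ((\<lambda>t. (t - 1) / ln t) has_real_derivative d) (at t) \<and> d \<ge> 0" by blast
qed

lemma w_fun_antimono:
  assumes "1 < y" "y \<le> y'" "x \<ge> 1"
  shows "w_fun y' x \<le> w_fun y x"
proof -
  have "y / x \<le> y' / x" using assms by (intro divide_right_mono) auto
  moreover have "(y - 1) / ln y * (ln x / x) \<le> (y' - 1) / ln y' * (ln x / x)"
    using assms by (intro mult_right_mono minus_one_div_ln_mono) auto
  ultimately show ?thesis by (simp add: w_fun_def)
qed

text \<open>This is where w comes from: bounding log_p (l - 1) by log_p l in the digit-sum estimate
  for n = l - 1 and solving for the multiplicity leaves exactly l w_p(l) / (p - 1).\<close>

lemma multiplicity_fact_ge_w_fun: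
  fixes p l :: nat
  assumes p: "prime p" and l: "l \<ge> 2"
  shows "real l / (real p - 1) * w_fun p l \<le> multiplicity p (fact (l - 1) :: nat)"
proof -
  have p1: "real p > 1" using p prime_gt_1_nat by fastforce
  let ?v = "real (multiplicity p (fact (l - 1) :: nat))"
  have "real l / (real p - 1) * w_fun p l = real l / (real p - 1) - real p / (real p - 1) - ln l / ln p"
  proof -
    have "real l / (real p - 1) * w_fun p l = real l / (real p - 1)
        - (real l / real l) * (real p / (real p - 1))
        - (real l / real l) * ((real p - 1) / (real p - 1)) * (ln l / ln p)"
      unfolding w_fun_def right_diff_distrib by (simp add: mult_ac)
    then show ?thesis using p1 l by simp
  qed
  also have "\<dots> = (real l - 1 - (real p - 1) * (1 + log p l)) / (real p - 1)"
  proof -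
    have "(real l - 1 - (real p - 1) * (1 + log p l)) / (real p - 1) =
        real l / (real p - 1) - 1 / (real p - 1) - (1 + log p l)"
      using p1 by (simp add: diff_divide_distrib)
    moreover have "real p / (real p - 1) = 1 + 1 / (real p - 1)" using p1 by (simp add: field_simps)
    ultimately show ?thesis by (simp add: log_def)
  qed
  also have "\<dots> \<le> ?v"
  proof -
    have "real (l - 1) \<le> (real p - 1) * (?v + 1 + log p (l - 1))"
      using multiplicity_fact_lower[OF p, of "l - 1"] l by simp
    also have "\<dots> \<le> (real p - 1) * (?v + 1 + log p l)"
      using p1 l by (intro mult_left_mono add_left_mono log_mono) auto
    finally have "real l - 1 \<le> (real p - 1) * (?v + 1 + log p l)" using l by (simp add: of_nat_diff)
    then show ?thesis using p1 by (simp add: divide_le_eq algebra_simps)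
  qed
  finally show ?thesis .
qed

section \<open>The lower bounds for \<open>D\<close> and \<open>kappa_m\<close>\<close>

lemma finite_small_primes [simp]: "finite (small_primes m)"
  by (rule finite_subset[of _ "{..m+1}"]) (auto simp: small_primes_def)

lemma s_fun_ge_1: "m \<ge> 2 \<Longrightarrow> s_fun m \<ge> 1"
proof -
  assume m: "m \<ge> 2"
  show ?thesis
  proof (cases "m = 2")
    case True
    then show ?thesis by (simp add: s_fun_def)
  next
    case False
    then have m3: "real m \<ge> 3" using m by simp
    have "exp 1 \<le> real m" using exp_le m3 by linarith
    then have "ln (real m) \<ge> 1" using m3 by (simp add: ln_ge_iff)
    then have "(ln (real m))\<^sup>2 \<ge> 1" by (simp add: one_le_power)
    then have "real m * (ln (real m))\<^sup>2 \<ge> 1 * 1" using m3 by (intro mult_mono) auto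
    then show ?thesis using False by (simp add: s_fun_def)
  qed
qed

text \<open>Places the threshold for l in the range x >= e, where ln x / x decreases and
  \<open>w_fun_mono\<close> applies.\<close>

lemma s_fun_exp_ge:
  assumes "m \<ge> 2"
  shows "exp 1 \<le> s_fun m * exp (s_fun m)"
proof -
  have "1 * exp 1 \<le> s_fun m * exp (s_fun m)"
    using s_fun_ge_1[OF assms] by (intro mult_mono) auto
  then show ?thesis by simp
qed

text \<open>After taking logarithms the claim holds prime by prime: w at the threshold is at most w
  at l, which \<open>multiplicity_fact_ge_w_fun\<close> turns into the multiplicity of p in (l -
  1)!.\<close>

lemma D_ge_exp_kappa_m:
  assumes m: "m \<ge> 2" and l: "real l \<ge> s_fun m * exp (s_fun m)"
  shows "real (D m l) \<ge> exp (kappa_m m * real m * real l)"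
proof -
  define X where "X = s_fun m * exp (s_fun m)"
  have X: "exp 1 \<le> X" "X \<le> l" using s_fun_exp_ge[OF m] l by (auto simp: X_def)
  have "exp (1::real) \<ge> 2" using exp_ge_add_one_self[of 1] by simp
  then have l2: "l \<ge> 2" using X by linarith
  have D0: "real (D m l) = (\<Prod>p\<in>small_primes m. real p ^ (mu m p * multiplicity p (fact (l - 1) :: nat)))"
    by (simp add: D_def)
  have pos: "p > 0" if "p \<in> small_primes m" for p
    using that prime_gt_0_nat by (auto simp: small_primes_def)
  have Dpos: "real (D m l) > 0" unfolding D0 using pos by (intro prod_pos) auto
  have "kappa_m m * real m * real l = (\<Sum>p\<in>small_primes m.
      real (mu m p) * (ln (real p) / (real p - 1)) * w_fun p X * l)"
    unfolding sum_distrib_right[symmetric] using m by (simp add: kappa_m_def X_def)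
  also have "\<dots> \<le> (\<Sum>p\<in>small_primes m.
      real (mu m p) * ln (real p) * multiplicity p (fact (l - 1) :: nat))"
  proof (rule sum_mono)
    fix p assume "p \<in> small_primes m"
    then have p: "prime p" by (simp add: small_primes_def)
    then have p1: "real p > 1" using prime_gt_1_nat by fastforce
    have "real l / (real p - 1) * w_fun p X \<le> real l / (real p - 1) * w_fun p l"
      using p1 X by (intro mult_left_mono w_fun_mono) auto
    also have "\<dots> \<le> multiplicity p (fact (l - 1) :: nat)"
      using multiplicity_fact_ge_w_fun[OF p l2] .
    finally have "real (mu m p) * ln p * (real l / (real p - 1) * w_fun p X)
        \<le> real (mu m p) * ln p * multiplicity p (fact (l - 1) :: nat)"
      using p1 by (intro mult_left_mono) auto
    then show "real (mu m p) * (ln (real p) / (real p - 1)) * w_fun p X * l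
        \<le> real (mu m p) * ln (real p) * multiplicity p (fact (l - 1) :: nat)"
      by (simp add: mult_ac)
  qed
  also have "\<dots> = ln (D m l)"
    unfolding D0 using pos by (subst ln_prod) (auto simp: ln_realpow intro!: sum.cong)
  finally show ?thesis using Dpos by (simp add: ln_ge_iff)
qed

lemma mu_eq:
  assumes "p > 0" "p \<le> m + 1"
  shows "mu m p = (m + 1) div p - 1"
proof -
  have m: "m + 1 = (m + 1 - p) + p" using assms by simp
  have d: "(m + 1) div p = (m + 1 - p) div p + 1"
    by (subst m, subst div_add_self2) (use assms in auto)
  show ?thesis unfolding mu_def
  proof (rule Min_eqI)
    fix y assume "y \<in> (\<lambda>j. j div p + (m - j) div p) ` {0..m}"
    then obtain j where j: "j \<le> m" "y = j div p + (m - j) div p" by auto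
    \<comment> \<open>Each of the two floors discards a remainder of at most p - 1, so m <= p y + 2
      (p - 1), that is, m + 1 < p (y + 2).\<close>
    have "j \<le> p * (j div p) + (p - 1)" "m - j \<le> p * ((m - j) div p) + (p - 1)"
      using assms mod_less_divisor[of p j] mult_div_mod_eq[of p j]
        mod_less_divisor[of p "m - j"] mult_div_mod_eq[of p "m - j"] by linarith+
    then have "m + 1 < p * (y + 2)" using j assms by (simp add: algebra_simps)
    then have "(m + 1) div p < y + 2" using assms by (simp add: less_mult_imp_div_less mult.commute)
    then show "(m + 1) div p - 1 \<le> y" by simp
  next
    \<comment> \<open>The choice j = p - 1 wastes the largest possible remainder on a zero quotient
      and leaves m + 1 - p for the second floor.\<close>
    have "(p - 1) div p + (m - (p - 1)) div p = (m + 1) div p - 1" using assms d by simp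
    moreover have "p - 1 \<in> {0..m}" using assms by auto
    ultimately show "(m + 1) div p - 1 \<in> (\<lambda>j. j div p + (m - j) div p) ` {0..m}"
      by (metis (no_types, lifting) image_eqI)
  qed simp
qed

lemma mu_small_primes:
  assumes "p \<in> small_primes m"
  shows "real (mu m p) = real ((m + 1) div p) - 1"
proof -
  have p: "p > 0" "2 * p \<le> m + 1"
    using assms prime_gt_0_nat by (auto simp: small_primes_def)
  have "(m + 1) div p \<ge> 1" using p by (simp add: Suc_leI div_greater_zero_iff)
  then show ?thesis using mu_eq[of p m] p by (simp add: of_nat_diff)
qed

text \<open>Every p in the sum is at most (m + 1)/2 and w decreases in its first argument, so w at
  (m + 1)/2 bounds all the factors from below and can be pulled out of the sum.\<close>

lemma kappa_m_lower:
  assumes m: "m \<ge> 2"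
  shows "kappa_m m \<ge> w_fun ((real m + 1) / 2) (s_fun m * exp (s_fun m)) * (1 / real m) *
      (\<Sum>p\<in>small_primes m. (real ((m + 1) div p) - 1) * (ln (real p) / (real p - 1)))"
proof -
  define X where "X = s_fun m * exp (s_fun m)"
  have X: "1 \<le> X" using s_fun_exp_ge[OF m] exp_ge_add_one_self[of 1] by (auto simp: X_def)
  have "(\<Sum>p\<in>small_primes m. w_fun ((real m + 1) / 2) X *
          ((real ((m + 1) div p) - 1) * (ln (real p) / (real p - 1))))
      \<le> (\<Sum>p\<in>small_primes m. real (mu m p) * (ln (real p) / (real p - 1)) * w_fun p X)"
  proof (rule sum_mono)
    fix p assume p: "p \<in> small_primes m"
    have p1: "real p > 1" using p prime_gt_1_nat by (fastforce simp: small_primes_def)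
    have "real (mu m p) * (ln (real p) / (real p - 1)) * w_fun ((real m + 1) / 2) X
        \<le> real (mu m p) * (ln (real p) / (real p - 1)) * w_fun p X"
      using p1 p X by (intro mult_left_mono w_fun_antimono) (auto simp: small_primes_def)
    then show "w_fun ((real m + 1) / 2) X * ((real ((m + 1) div p) - 1) * (ln (real p) / (real p - 1)))
        \<le> real (mu m p) * (ln (real p) / (real p - 1)) * w_fun p X"
      by (simp add: mu_small_primes[OF p] mult_ac)
  qed
  then have "1 / real m * (\<Sum>p\<in>small_primes m. w_fun ((real m + 1) / 2) X *
          ((real ((m + 1) div p) - 1) * (ln (real p) / (real p - 1)))) \<le> kappa_m m"
    unfolding kappa_m_def X_def by (intro mult_left_mono) auto
  then show ?thesis by (simp add: X_def sum_distrib_left mult_ac)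
qed

section \<open>The limit\<close>

lemma w_fun_le_1:
  assumes "y > 1" "x \<ge> 1"
  shows "w_fun y x \<le> 1"
proof -
  have "y / x \<ge> 0" "(y - 1) / ln y * (ln x / x) \<ge> 0" using assms by auto
  then show ?thesis unfolding w_fun_def by linarith
qed

lemma s_fun_eventually: "\<forall>\<^sub>F m in sequentially. s_fun m = real m * (ln (real m))\<^sup>2"
  using eventually_gt_at_top[of 2] by eventually_elim (simp add: s_fun_def)

lemma s_fun_exp_at_top: "filterlim (\<lambda>m. s_fun m * exp (s_fun m)) at_top sequentially"
proof -
  have "filterlim (\<lambda>m. real m * (ln (real m))\<^sup>2 * exp (real m * (ln (real m))\<^sup>2)) at_top sequentially"
    by real_asymp
  then show ?thesis
    by (rule filterlim_mono_eventually)
      (auto intro: eventually_mono[OF s_fun_eventually])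
qed

lemma w_fun_tendsto_1: "((\<lambda>x. w_fun y x) \<longlongrightarrow> 1) at_top"
proof -
  have 1: "((\<lambda>x::real. y * inverse x) \<longlongrightarrow> y * 0) at_top"
    by (intro tendsto_mult_left tendsto_inverse_0_at_top filterlim_ident)
  have 2: "((\<lambda>x::real. (y - 1) / ln y * (ln x / x)) \<longlongrightarrow> (y - 1) / ln y * 0) at_top"
    by (intro tendsto_mult_left ln_x_over_x_tendsto_0) 
  have "((\<lambda>x. 1 - y * inverse x - (y - 1) / ln y * (ln x / x)) \<longlongrightarrow> 1 - y * 0 - (y - 1) / ln y * 0) at_top"
    by (intro tendsto_diff tendsto_const 1 2)
  then show ?thesis by (simp add: w_fun_def divide_inverse)
qed

text \<open>Here the first argument grows with m. By antitonicity this one limit makes w positive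
  for all small primes simultaneously, which the domination argument needs.\<close>

lemma w_fun_half_tendsto_1:
  "(\<lambda>m. w_fun ((real m + 1) / 2) (s_fun m * exp (s_fun m))) \<longlonglongrightarrow> 1"
proof -
  have "(\<lambda>m. w_fun ((real m + 1) / 2) (real m * (ln (real m))\<^sup>2 * exp (real m * (ln (real m))\<^sup>2))) \<longlonglongrightarrow> 1"
    unfolding w_fun_def by real_asymp
  then show ?thesis
    by (rule Lim_transform_eventually) (auto intro: eventually_mono[OF s_fun_eventually])
qed

section \<open>Convergence of the series for kappa and of \<open>kappa_m\<close>\<close>

definition kappa_term :: "nat \<Rightarrow> real" where
  "kappa_term p = ln (real p) / (real p * (real p - 1))"

lemma kappa_term_nonneg: "kappa_term p \<ge> 0"
  by (cases "p = 0") (auto simp: kappa_term_def)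

lemma summable_kappa_term: "summable kappa_term"
proof (rule summable_comparison_test_bigo)
  show "summable (\<lambda>n. norm (real n powr (-3/2)))" by (simp add: summable_real_powr_iff)
  \<comment> \<open>Half a power of n absorbs the logarithm in ln n / n^2, and the exponent -3/2
    still gives a convergent series.\<close>
  show "kappa_term \<in> O(\<lambda>n. real n powr (-3/2))" unfolding kappa_term_def by real_asymp
qed

text \<open>An unordered infinite sum is 0 by convention when the family is not summable; this
  excludes that reading of \<open>kappa\<close>.\<close>

lemma kappa_term_summable_on: "kappa_term summable_on A"
proof -
  have "kappa_term summable_on UNIV"
    using summable_kappa_term kappa_term_nonneg by (intro summable_nonneg_imp_summable_on)
  then show ?thesis by (rule summable_on_subset_banach) simp
qed

lemma kappa_sums: "(\<lambda>p. if prime p then kappa_term p else 0) sums kappa"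
proof -
  have "(kappa_term has_sum kappa) {p. prime p}"
    using kappa_term_summable_on by (simp add: kappa_def kappa_term_def[abs_def])
  then have "((\<lambda>p. if prime p then kappa_term p else 0) has_sum kappa) UNIV"
    by (subst has_sum_cong_neutral[where T = "{p. prime p}" and g = kappa_term]) auto
  then show ?thesis by (rule has_sum_imp_sums)
qed

lemma mu_div_tendsto:
  assumes "prime p"
  shows "(\<lambda>m. real (mu m p) / real m) \<longlonglongrightarrow> 1 / real p"
proof (rule tendsto_sandwich)
  have p0: "p > 0" using assms prime_gt_0_nat by blast
  have ev: "\<forall>\<^sub>F m in sequentially. m > 0 \<and> p \<in> small_primes m"
    using eventually_gt_at_top[of "2 * p"] by eventually_elim (use assms in \<open>auto simp: small_primes_def\<close>)
  \<comment> \<open>Of the 2, one unit is lost to the floor and one is the -1 in the formula for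
    \<open>mu\<close>.\<close>
  show "\<forall>\<^sub>F m in sequentially. ((real m + 1) / real p - 2) / real m \<le> real (mu m p) / real m"
    using ev
  proof eventually_elim
    case (elim m)
    have "real (m + 1) / real p - real ((m + 1) div p) \<le> 1" 
      using real_of_int_div3[of "int (m + 1)" "int p"] by (simp only: of_int_of_nat_eq flip: of_nat_div)
    then show ?case using elim mu_small_primes[of p m] by (intro divide_right_mono) (auto simp: add.commute)
  qed
  show "\<forall>\<^sub>F m in sequentially. real (mu m p) / real m \<le> ((real m + 1) / real p) / real m"
    using ev
  proof eventually_elim
    case (elim m)
    have "real ((m + 1) div p) \<le> real (m + 1) / real p" by (rule of_nat_div_le_of_nat)
    then show ?case using elim mu_small_primes[of p m] by (intro divide_right_mono) (auto simp: add.commute)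
  qed
  have p0': "real p > 0" using p0 by simp
  show "(\<lambda>m. ((real m + 1) / real p - 2) / real m) \<longlonglongrightarrow> 1 / real p"
    using p0' by (real_asymp, simp add: inverse_eq_divide)
  show "(\<lambda>m. (real m + 1) / real p / real m) \<longlonglongrightarrow> 1 / real p"
    using p0' by (real_asymp, simp add: inverse_eq_divide)
qed

text \<open>The -1 in the formula for \<open>mu\<close> absorbs the 1/p by which (m + 1)/p exceeds
  m/p. The constant is exactly 1, so the summands of \<open>kappa\<close> themselves serve as the
  dominating series.\<close>

lemma mu_div_le:
  assumes "p \<in> small_primes m" "m \<ge> 1"
  shows "real (mu m p) / real m \<le> 1 / real p"
proof -
  have p0: "real p \<ge> 1" using assms prime_ge_1_nat by (fastforce simp: small_primes_def)
  have "real (mu m p) \<le> (real m + 1) / real p - 1"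
    using of_nat_div_le_of_nat[of "m + 1" p, where ?'a = real] mu_small_primes[OF assms(1)] by (simp add: add.commute)
  also have "\<dots> \<le> real m / real p" using p0 by (simp add: field_simps)
  finally have "real (mu m p) / real m \<le> real m / real p / real m" by (intro divide_right_mono) auto
  then show ?thesis using assms by simp
qed

text \<open>Tannery's theorem (dominated convergence for series): \<open>kappa_m\<close> is written
  as a series over all naturals whose terms vanish outside the small primes, converge for fixed p,
  and are eventually bounded by the limiting summands.\<close>

lemma kappa_m_tendsto: "kappa_m \<longlonglongrightarrow> kappa"
proof -
  define X where "X m = s_fun m * exp (s_fun m)" for m
  define a where "a p m = (if p \<in> small_primes m then real (mu m p) / real m *
      (ln (real p) / (real p - 1)) * w_fun p (X m) else 0)" for p m
  define b where "b p = (if prime p then kappa_term p else 0)" for p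
  have suma: "kappa_m m = suminf (\<lambda>p. a p m)" for m
  proof -
    have "suminf (\<lambda>p. a p m) = (\<Sum>p\<in>small_primes m. a p m)"
      by (intro suminf_finite) (auto simp: a_def)
    also have "\<dots> = kappa_m m"
      by (simp add: kappa_m_def a_def X_def sum_distrib_left mult_ac)
    finally show ?thesis ..
  qed
  have X_lim: "filterlim X at_top sequentially"
    using s_fun_exp_at_top by (simp add: X_def[abs_def])
  have lim: "(\<lambda>m. a p m) \<longlonglongrightarrow> b p" for p
  proof (cases "prime p")
    case True
    have "(\<lambda>m. real (mu m p) / real m * (ln (real p) / (real p - 1)) * w_fun p (X m)) \<longlonglongrightarrow>
        1 / real p * (ln (real p) / (real p - 1)) * 1"
      by (intro tendsto_mult tendsto_const mu_div_tendsto True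
          filterlim_compose[OF w_fun_tendsto_1 X_lim])
    moreover have "\<forall>\<^sub>F m in sequentially. p \<in> small_primes m"
      using eventually_gt_at_top[of "2 * p"]
      by eventually_elim (use True in \<open>auto simp: small_primes_def\<close>)
    then have "\<forall>\<^sub>F m in sequentially. real (mu m p) / real m * (ln (real p) / (real p - 1)) * w_fun p (X m) = a p m"
      by eventually_elim (simp add: a_def)
    ultimately have "(\<lambda>m. a p m) \<longlonglongrightarrow> 1 / real p * (ln (real p) / (real p - 1)) * 1"
      by (rule Lim_transform_eventually)
    then show ?thesis using True by (simp add: b_def kappa_term_def)
  next
    case False
    then have "a p = (\<lambda>m. 0)" by (auto simp: a_def small_primes_def)
    then show ?thesis using False by (simp add: b_def)
  qed
  \<comment> \<open>Positivity at the largest admissible first argument puts all the factors w_p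
    between 0 and 1, so absolute values can be bounded.\<close>
  have "\<forall>\<^sub>F m in sequentially. w_fun ((real m + 1) / 2) (X m) > 0"
    using order_tendstoD(1)[OF w_fun_half_tendsto_1, of 0] by (simp add: X_def)
  then have "\<forall>\<^sub>F m in sequentially. \<forall>p. norm (a p m) \<le> b p"
    using eventually_ge_at_top[of 2]
  proof eventually_elim
    case (elim m)
    show ?case
    proof
      fix p
      show "norm (a p m) \<le> b p"
      proof (cases "p \<in> small_primes m")
        case True
        have p1: "real p > 1" and pp: "prime p" and pm: "real p \<le> (real m + 1) / 2"
          using True prime_gt_1_nat by (fastforce simp: small_primes_def)+
        have X1: "X m \<ge> 1" using s_fun_exp_ge[OF elim(2)] exp_ge_add_one_self[of 1]
          unfolding X_def by linarith
        have w: "0 \<le> w_fun p (X m)" "w_fun p (X m) \<le> 1"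
          using w_fun_antimono[OF p1 pm X1] elim(1) w_fun_le_1[OF p1 X1] by auto
        have "real (mu m p) / real m * (ln (real p) / (real p - 1)) * w_fun p (X m)
            \<le> 1 / real p * (ln (real p) / (real p - 1)) * 1"
          using mu_div_le[OF True] elim p1 w by (intro mult_mono) auto
        moreover have "0 \<le> real (mu m p) / real m * (ln (real p) / (real p - 1)) * w_fun p (X m)"
          using p1 w by auto
        ultimately have "\<bar>real (mu m p) / real m * (ln (real p) / (real p - 1)) * w_fun p (X m)\<bar>
            \<le> 1 / real p * (ln (real p) / (real p - 1)) * 1" by linarith
        then show ?thesis using True pp unfolding a_def b_def kappa_term_def by simp
      next
        case False
        then show ?thesis by (simp add: a_def b_def kappa_term_nonneg)
      qed
    qed
  qed
  then have ev: "eventually (\<lambda>(p, m). norm (a p m) \<le> b p) (at_top \<times>\<^sub>F sequentially)"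
    unfolding eventually_prod_filter
    by (intro exI[of _ "\<lambda>_. True"] exI[of _ "\<lambda>m. \<forall>p. norm (a p m) \<le> b p"]) auto
  have "summable b" using kappa_sums unfolding b_def by (rule sums_summable)
  then have "(\<lambda>m. suminf (\<lambda>p. a p m)) \<longlonglongrightarrow> suminf b"
    using tannerys_theorem[OF lim ev] by simp
  moreover have "suminf b = kappa" using kappa_sums unfolding b_def by (rule sums_unique[symmetric])
  ultimately show ?thesis by (simp add: suma[abs_def])
qed

section \<open>The logarithmic derivative of zeta as a sum over primes\<close>

text \<open>For k >= 2 this is zeta(k): the term at n = 0 vanishes because division by zero gives
  0.\<close>

definition zeta_sum :: "nat \<Rightarrow> real" where
  "zeta_sum k = (\<Sum>n. 1 / real n ^ k)"

text \<open>For k >= 2 this is -zeta'(k), again with a vanishing term at n = 0.\<close>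

definition zeta_ln_sum :: "nat \<Rightarrow> real" where
  "zeta_ln_sum k = (\<Sum>n. ln (real n) / real n ^ k)"

lemma zeta_sum_sums:
  assumes "k \<ge> 2"
  shows "(\<lambda>n. 1 / real n ^ k) sums zeta_sum k"
  unfolding zeta_sum_def using inverse_power_summable[OF assms, where ?'a = real]
  by (intro summable_sums) (simp add: inverse_eq_divide)

lemma zeta_ln_sum_sums:
  assumes "k \<ge> 2"
  shows "(\<lambda>n. ln (real n) / real n ^ k) sums zeta_ln_sum k"
  unfolding zeta_ln_sum_def
proof (rule summable_sums, rule summable_comparison_test)
  have "summable (\<lambda>n. ln (real n) / real n ^ 2)"
  proof (rule summable_comparison_test_bigo)
    show "summable (\<lambda>n. norm (real n powr (-3/2)))" by (simp add: summable_real_powr_iff)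
    show "(\<lambda>n. ln (real n) / real n ^ 2) \<in> O(\<lambda>n. real n powr (-3/2))" by real_asymp
  qed
  then show "summable (\<lambda>n. ln (real n) / real n ^ 2)" .
  show "\<exists>N. \<forall>n\<ge>N. norm (ln (real n) / real n ^ k) \<le> ln (real n) / real n ^ 2"
  proof (intro exI allI impI)
    fix n :: nat assume n: "n \<ge> 1"
    have "ln (real n) / real n ^ k \<le> ln (real n) / real n ^ 2"
      using n assms by (intro divide_left_mono power_increasing) auto
    then show "norm (ln (real n) / real n ^ k) \<le> ln (real n) / real n ^ 2" using n by simp
  qed
qed

lemma has_sum_pos_of_sums:
  fixes f :: "nat \<Rightarrow> real"
  assumes "f sums S" "\<And>n. f n \<ge> 0" "f 0 = 0"
  shows "(f has_sum S) {0<..}"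
proof -
  have "(f has_sum S) UNIV" using assms by (intro sums_nonneg_imp_has_sum) auto
  then show ?thesis
    by (subst has_sum_cong_neutral[where T = UNIV and g = f]) (use assms in auto)
qed

text \<open>The Dirichlet series form of ln n = sum of Lambda(d) over d dividing n: the series of ln
  is the series of Lambda times zeta. Nonnegative terms allow the double sum to be
  rearranged.\<close>

lemma mangoldt_zeta_product:
  assumes k: "k \<ge> 2"
  shows "((\<lambda>d. mangoldt d / real d ^ k) has_sum (zeta_ln_sum k / zeta_sum k)) {0<..}"
proof -
  define f :: "nat \<times> nat \<Rightarrow> real" where "f = (\<lambda>(n, d). mangoldt d / real n ^ k)"
  have z: "((\<lambda>n. 1 / real n ^ k) has_sum zeta_sum k) {0<..}"
    using zeta_sum_sums[OF k] k by (intro has_sum_pos_of_sums) auto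
  have ln_nonneg: "ln (real n) \<ge> 0" for n :: nat by (cases "n = 0") auto
  have zl: "((\<lambda>n. ln (real n) / real n ^ k) has_sum zeta_ln_sum k) {0<..}"
    using zeta_ln_sum_sums[OF k] k by (intro has_sum_pos_of_sums) (auto intro!: divide_nonneg_nonneg ln_nonneg)
  have inner: "((\<lambda>d. f (n, d)) has_sum ln (real n) / real n ^ k) {d. d dvd n}" if "n \<in> {0<..}" for n
  proof -
    have "(\<Sum>d | d dvd n. f (n, d)) = ln (real n) / real n ^ k"
      using that mangoldt_sum[of n, where ?'a = real] by (simp add: f_def flip: sum_divide_distrib)
    then show ?thesis using that by (intro has_sum_finiteI) auto
  qed
  have "f summable_on (SIGMA n:{0<..}. {d. d dvd n})"
    using zl by (intro summable_on_SigmaI[OF inner])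
      (auto simp: f_def mangoldt_nonneg intro: has_sum_imp_summable)
  then have "(f has_sum zeta_ln_sum k) (SIGMA n:{0<..}. {d. d dvd n})"
    using inner zl by (intro has_sum_SigmaI) auto
  \<comment> \<open>The pairs (n, d) with d dividing n are reparametrised by n = d m, which
    separates the variables.\<close>
  also have "?this \<longleftrightarrow> ((\<lambda>(d, m). mangoldt d / real (d * m) ^ k) has_sum zeta_ln_sum k) ({0<..} \<times> {0<..})"
    by (rule has_sum_reindex_bij_witness[of _ "\<lambda>(d, m). (d * m, d)" "\<lambda>(n, d). (d, n div d)"])
      (auto simp: f_def dvd_div_eq_0_iff intro: Nat.gr0I)
  finally have "((\<lambda>d. mangoldt d / real d ^ k * zeta_sum k) has_sum zeta_ln_sum k) {0<..}"
  proof (rule has_sum_SigmaD)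
    fix d :: nat assume "d \<in> {0<..}"
    have "((\<lambda>m. mangoldt d / real d ^ k * (1 / real m ^ k)) has_sum mangoldt d / real d ^ k * zeta_sum k) {0<..}"
      by (intro has_sum_cmult_right z)
    then show "((\<lambda>m. case (d, m) of (d, m) \<Rightarrow> mangoldt d / real (d * m) ^ k) has_sum
        mangoldt d / real d ^ k * zeta_sum k) {0<..}"
      by (simp add: power_mult_distrib)
  qed
  then have "((\<lambda>d. mangoldt d / real d ^ k * zeta_sum k * inverse (zeta_sum k)) has_sum
      zeta_ln_sum k * inverse (zeta_sum k)) {0<..}"
    by (rule has_sum_cmult_left)
  moreover have "zeta_sum k > 0"
  proof -
    have "(\<Sum>n\<in>{1}. 1 / real n ^ k) \<le> zeta_sum k"
      using zeta_sum_sums[OF k] unfolding sums_iff by (intro sum_le_suminf[THEN order_trans]) auto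
    then show ?thesis by simp
  qed
  ultimately show ?thesis by (simp add: divide_inverse mult.assoc)
qed

text \<open>Lambda lives on prime powers, where it equals ln p; for fixed p the powers p^(j+1)
  contribute a geometric series with ratio p^(-k).\<close>

lemma primes_zeta_log_derivative:
  assumes k: "k \<ge> 2"
  shows "((\<lambda>p. ln (real p) / (real p ^ k - 1)) has_sum (zeta_ln_sum k / zeta_sum k)) {p. prime p}"
proof -
  let ?L = "zeta_ln_sum k / zeta_sum k"
  have "((\<lambda>d. mangoldt d / real d ^ k) has_sum ?L) {d. primepow d}"
    using mangoldt_zeta_product[OF k]
    by (subst has_sum_cong_neutral[where T = "{0<..}" and g = "\<lambda>d. mangoldt d / real d ^ k"])
      (auto simp: mangoldt_def dest: primepow_gt_0_nat)
  then have "((\<lambda>x. mangoldt (case x of (p, j) \<Rightarrow> p ^ Suc j) / real (case x of (p, j) \<Rightarrow> p ^ Suc j) ^ k) has_sum ?L)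
      ({p. prime p} \<times> UNIV)"
    using has_sum_reindex_bij_betw[OF bij_betw_primepows[where ?'a = nat],
        of "\<lambda>d. mangoldt d / real d ^ k"] by simp
  then show ?thesis
  proof (rule has_sum_SigmaD)
    fix p :: nat assume "p \<in> {p. prime p}"
    then have p: "prime p" by simp
    then have p1: "real p > 1" using prime_gt_1_nat by fastforce
    define x where "x = 1 / real p ^ k"
    have pk: "real p ^ k > 1" using p1 k by (intro one_less_power) auto
    have x: "0 < x" "x < 1" using pk p1 by (auto simp: x_def divide_less_eq)
    have "(\<lambda>j. ln p * x * x ^ j) sums (ln p * x * (1 / (1 - x)))"
      using x by (intro sums_mult geometric_sums) auto
    then have "((\<lambda>j. ln p * x * x ^ j) has_sum (ln p * x * (1 / (1 - x)))) UNIV"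
      using x p1 by (intro sums_nonneg_imp_has_sum) auto
    moreover have "ln p * x * (1 / (1 - x)) = ln p / (real p ^ k - 1)"
      using pk by (simp add: x_def field_simps)
    moreover have "mangoldt (p ^ Suc j) / real (p ^ Suc j) ^ k = ln p * x * x ^ j" for j
    proof -
      have "real (p ^ Suc j) ^ k = (real p ^ k) ^ Suc j"
        by (metis of_nat_power power_mult mult.commute)
      moreover have "mangoldt (p ^ Suc j) = ln p" using mangoldt_primepow'[OF p, of "Suc j", where ?'a = real] by simp
      ultimately show ?thesis by (simp add: x_def power_divide)
    qed
    ultimately show "((\<lambda>j. mangoldt (case (p, j) of (p, j) \<Rightarrow> p ^ Suc j) /
        real (case (p, j) of (p, j) \<Rightarrow> p ^ Suc j) ^ k) has_sum ln p / (real p ^ k - 1)) UNIV"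
      by simp
  qed
qed

section \<open>Euler-Maclaurin summation\<close>

text \<open>Here \<open>f 0\<close> is an antiderivative of the summand \<open>f 1\<close>, and \<open>f (k + 1)\<close> is the derivative of
  \<open>f k\<close>; the coefficients are \<open>- B\<^sub>k / k!\<close> for \<open>k = 0, 1, 2, 4, 6\<close>.\<close>

definition euler_maclaurin_8 :: "(nat \<Rightarrow> real \<Rightarrow> real) \<Rightarrow> real \<Rightarrow> real" where
  "euler_maclaurin_8 f x = - f 0 x + f 1 x / 2 - f 2 x / 12 + f 4 x / 720 - f 6 x / 30240"

text \<open>The polynomial is \<open>B\<^sub>8(t) - B\<^sub>8\<close>.\<close>

lemma bernpoly_8_bounds:
  fixes t :: real
  assumes "0 \<le> t" "t \<le> 1"
  shows "0 \<le> t^8 - 4*t^7 + 14/3*t^6 - 7/3*t^4 + 2/3*t^2"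
    and "t^8 - 4*t^7 + 14/3*t^6 - 7/3*t^4 + 2/3*t^2 \<le> 1/15"
proof -
  \<comment> \<open>The polynomial is symmetric about t = 1/2, hence a polynomial in t (1 - t). Its
    coefficients in u are nonnegative, so on 0 <= u <= 1/4 it is largest at u = 1/4, with value
    17/256 < 1/15.\<close>
  define u where "u = t * (1 - t)"
  have u0: "0 \<le> u" using assms by (simp add: u_def)
  have "0 \<le> (t - 1/2)\<^sup>2" by simp
  then have u1: "u \<le> 1/4" by (simp add: u_def power2_eq_square algebra_simps)
  have eq: "t^8 - 4*t^7 + 14/3*t^6 - 7/3*t^4 + 2/3*t^2 = u^2 * (2/3 + 4/3*u + u^2)"
    by (simp add: u_def eval_nat_numeral field_simps)
  show "0 \<le> t^8 - 4*t^7 + 14/3*t^6 - 7/3*t^4 + 2/3*t^2" unfolding eq using u0 by simp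
  have "u^2 * (2/3 + 4/3*u + u^2) \<le> (1/4)^2 * (2/3 + 4/3*(1/4) + (1/4)^2)"
    using u0 u1 by (intro mult_mono add_mono power_mono) auto
  also have "\<dots> \<le> 1/15" by (simp add: power2_eq_square)
  finally show "t^8 - 4*t^7 + 14/3*t^6 - 7/3*t^4 + 2/3*t^2 \<le> 1/15" unfolding eq .
qed

text \<open>The derivative of the auxiliary H lies between 0 and f 9 / 604800, where 604800 = 15 *
  8!. Integrating over the unit interval bounds H 1 - H 0, which is the local error.\<close>

lemma euler_maclaurin_8_step:
  fixes f :: "nat \<Rightarrow> real \<Rightarrow> real"
  assumes der: "\<And>k x. k \<le> 8 \<Longrightarrow> x \<ge> c \<Longrightarrow> (f k has_real_derivative f (Suc k) x) (at x)"
    and pos: "\<And>x. x \<ge> c \<Longrightarrow> f 9 x \<ge> 0"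
  shows "\<bar>euler_maclaurin_8 f c - euler_maclaurin_8 f (c + 1) - f 1 c\<bar> \<le> (f 8 (c + 1) - f 8 c) / 604800"
proof -
  \<comment> \<open>\<open>H = \<Sum>\<^sub>k (-1)^k B\<^sub>k(t) f k (c + t) / k!\<close> with \<open>B\<^sub>8(t)\<close> replaced by \<open>B\<^sub>8(t) - B\<^sub>8\<close>: since
    \<open>B\<^sub>k' = k B\<^sub>k\<^sub>-\<^sub>1\<close>, its derivative telescopes to the last term, which has constant sign.\<close>
  define H where "H t = f 0 (c + t) - (t - 1/2) * f 1 (c + t) + (t^2 - t + 1/6) / 2 * f 2 (c + t)
    - (t^3 - 3/2*t^2 + t/2) / 6 * f 3 (c + t) + (t^4 - 2*t^3 + t^2 - 1/30) / 24 * f 4 (c + t)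
    - (t^5 - 5/2*t^4 + 5/3*t^3 - t/6) / 120 * f 5 (c + t)
    + (t^6 - 3*t^5 + 5/2*t^4 - t^2/2 + 1/42) / 720 * f 6 (c + t)
    - (t^7 - 7/2*t^6 + 7/2*t^5 - 7/6*t^3 + t/6) / 5040 * f 7 (c + t)
    + (t^8 - 4*t^7 + 14/3*t^6 - 7/3*t^4 + 2/3*t^2) / 40320 * f 8 (c + t)" for t
  define P where "P t = (t^8 - 4*t^7 + 14/3*t^6 - 7/3*t^4 + 2/3*t^2) / 40320" for t :: real
  have P: "0 \<le> P t" "P t \<le> 1 / 604800" if "0 \<le> t" "t \<le> 1" for t
    using bernpoly_8_bounds[OF that] by (auto simp: P_def)
  have d: "((\<lambda>t. f k (c + t)) has_real_derivative f (Suc k) (c + t)) (at t)" if "k \<le> 8" "t \<ge> 0" for k t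
    using der[of k "c + t"] that DERIV_shift[of "f k" "f (Suc k) (c + t)" t c] by (simp add: add.commute)
  have H': "(H has_real_derivative P t * f 9 (c + t)) (at t)" if "t \<ge> 0" for t
    unfolding H_def
    by ((rule derivative_eq_intros d that refl | simp)+)
      (simp add: P_def eval_nat_numeral field_simps)
  have "H 0 \<le> H 1"
  proof (rule DERIV_nonneg_imp_nondecreasing[of 0 1 H])
    fix t :: real assume "0 \<le> t" "t \<le> 1"
    then show "\<exists>y. (H has_real_derivative y) (at t) \<and> y \<ge> 0"
      using H'[of t] P[of t] pos[of "c + t"] by auto
  qed simp
  moreover have "f 8 (c + 0) / 604800 - H 0 \<le> f 8 (c + 1) / 604800 - H 1"
  proof (rule DERIV_nonneg_imp_nondecreasing[of 0 1 "\<lambda>t. f 8 (c + t) / 604800 - H t"])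
    fix t :: real assume t: "0 \<le> t" "t \<le> 1"
    have "((\<lambda>t. f 8 (c + t) / 604800 - H t) has_real_derivative
        f 9 (c + t) / 604800 - P t * f 9 (c + t)) (at t)"
      using H'[of t] d[of 8 t] t by (auto intro!: derivative_eq_intros)
    moreover have "P t * f 9 (c + t) \<le> 1 / 604800 * f 9 (c + t)"
      using P[OF t] pos[of "c + t"] t by (intro mult_right_mono) auto
    ultimately show "\<exists>y. ((\<lambda>t. f 8 (c + t) / 604800 - H t) has_real_derivative y) (at t) \<and> y \<ge> 0"
      by (intro exI[of _ "f 9 (c + t) / 604800 - P t * f 9 (c + t)"]) auto
  qed simp
  \<comment> \<open>From t = 0 to t = 1 only B_1 changes its value, from -1/2 to 1/2, which produces
    the summand \<open>f 1 c\<close>; the higher odd Bernoulli polynomials vanish at both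
    ends.\<close>
  moreover have "H 1 - H 0 = euler_maclaurin_8 f c - euler_maclaurin_8 f (c + 1) - f 1 c"
    by (simp add: H_def euler_maclaurin_8_def)
  ultimately show ?thesis by (auto simp: diff_divide_distrib)
qed

text \<open>Both the local errors and their bounds telescope over M, M + 1, ...; as all
  \<open>f k\<close> tend to 0, only the values at M survive in the limit.\<close>

lemma euler_maclaurin_8_tail:
  fixes f :: "nat \<Rightarrow> real \<Rightarrow> real" and M :: nat
  assumes der: "\<And>k x. k \<le> 8 \<Longrightarrow> x \<ge> real M \<Longrightarrow> (f k has_real_derivative f (Suc k) x) (at x)"
    and pos: "\<And>x. x \<ge> real M \<Longrightarrow> f 9 x \<ge> 0"
    and lim: "\<And>k. k \<le> 8 \<Longrightarrow> (f k \<longlongrightarrow> 0) at_top"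
    and sums: "h sums S" and h: "\<And>n. n \<ge> M \<Longrightarrow> h n = f 1 (real n)"
  shows "\<bar>S - (\<Sum>n<M. h n) - euler_maclaurin_8 f M\<bar> \<le> - f 8 M / 604800"
proof -
  define G where "G = euler_maclaurin_8 f"
  have part: "\<bar>(\<Sum>n<M + j. h n) - (\<Sum>n<M. h n) - (G M - G (real (M + j)))\<bar>
      \<le> (f 8 (real (M + j)) - f 8 M) / 604800" for j
  proof (induction j)
    case (Suc j)
    have "\<bar>G (real (M + j)) - G (real (M + j) + 1) - f 1 (real (M + j))\<bar>
        \<le> (f 8 (real (M + j) + 1) - f 8 (real (M + j))) / 604800"
      unfolding G_def by (rule euler_maclaurin_8_step) (use der pos in auto)
    moreover have "real (M + j) + 1 = real (M + Suc j)" by simp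
    ultimately have "\<bar>G (real (M + j)) - G (real (M + Suc j)) - h (M + j)\<bar>
        \<le> (f 8 (real (M + Suc j)) - f 8 (real (M + j))) / 604800"
      using h[of "M + j"] by (simp only: le_add1)
    moreover have "(\<Sum>n<M + Suc j. h n) = (\<Sum>n<M + j. h n) + h (M + j)" by simp
    ultimately show ?case using Suc by (simp only: diff_divide_distrib)
  qed simp
  have filt: "filterlim (\<lambda>j. real (M + j)) at_top sequentially"
    by (rule filterlim_compose[OF filterlim_real_sequentially])
      (simp add: add.commute filterlim_add_const_nat_at_top)
  have f0: "(\<lambda>j. f k (real (M + j))) \<longlonglongrightarrow> 0" if "k \<le> 8" for k
    by (rule filterlim_compose[OF lim[OF that] filt])
  have G0: "(\<lambda>j. G (real (M + j))) \<longlonglongrightarrow> - 0 + 0 / 2 - 0 / 12 + 0 / 720 - 0 / 30240"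
    unfolding G_def euler_maclaurin_8_def by (intro tendsto_intros f0) auto
  have S: "(\<lambda>j. (\<Sum>n<M + j. h n)) \<longlonglongrightarrow> S"
    using LIMSEQ_ignore_initial_segment[OF sums[unfolded sums_def], of M] by (simp add: add.commute)
  have L: "(\<lambda>j. \<bar>(\<Sum>n<M + j. h n) - (\<Sum>n<M. h n) - (G M - G (real (M + j)))\<bar>)
      \<longlonglongrightarrow> \<bar>S - (\<Sum>n<M. h n) - (G M - (- 0 + 0 / 2 - 0 / 12 + 0 / 720 - 0 / 30240))\<bar>"
    by (intro tendsto_intros S G0)
  have R: "(\<lambda>j. (f 8 (real (M + j)) - f 8 M) / 604800) \<longlonglongrightarrow> (0 - f 8 M) / 604800"
    by (intro tendsto_intros f0) auto
  have "\<bar>S - (\<Sum>n<M. h n) - (G M - (- 0 + 0 / 2 - 0 / 12 + 0 / 720 - 0 / 30240))\<bar>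
      \<le> (0 - f 8 M) / 604800"
    by (rule LIMSEQ_le[OF L R]) (use part in auto)
  then show ?thesis by (simp add: G_def)
qed

text \<open>Coefficients of the \<open>k\<close>-th derivative of \<open>(a ln x + b) / x^q\<close>, which is
  \<open>(a\<^sub>k ln x + b\<^sub>k) / x^(q+k)\<close>.\<close>

primrec ln_pow_coeffs :: "real \<Rightarrow> real \<Rightarrow> nat \<Rightarrow> nat \<Rightarrow> real \<times> real" where
  "ln_pow_coeffs a b q 0 = (a, b)"
| "ln_pow_coeffs a b q (Suc k) =
    (case ln_pow_coeffs a b q k of (a', b') \<Rightarrow> (- real (q + k) * a', a' - real (q + k) * b'))"

definition ln_pow :: "real \<Rightarrow> real \<Rightarrow> nat \<Rightarrow> nat \<Rightarrow> real \<Rightarrow> real" where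
  "ln_pow a b q k x = (fst (ln_pow_coeffs a b q k) * ln x + snd (ln_pow_coeffs a b q k)) / x ^ (q + k)"

lemma ln_pow_has_derivative:
  assumes "x > 0"
  shows "(ln_pow a b q k has_real_derivative ln_pow a b q (Suc k) x) (at x)"
proof -
  obtain c d where cd: "ln_pow_coeffs a b q k = (c, d)" by fastforce
  define r where "r = q + k"
  have "((\<lambda>x. (c * ln x + d) / x ^ r) has_real_derivative
      (- real r * c * ln x + (c - real r * d)) / x ^ Suc r) (at x)"
  proof -
    have "((\<lambda>x. c * ln x + d) has_real_derivative c / x) (at x)"
      using assms by (auto intro!: derivative_eq_intros)
    from DERIV_quotient[OF this DERIV_pow[of r x]] assms
    have "((\<lambda>x. (c * ln x + d) / x ^ r) has_real_derivative
        (c / x * x ^ r - real r * x ^ (r - Suc 0) * (c * ln x + d)) / (x ^ r) ^ Suc (Suc 0)) (at x)"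
      by simp
    moreover have "(c / x * x ^ r - real r * x ^ (r - Suc 0) * (c * ln x + d)) / (x ^ r) ^ Suc (Suc 0) =
        (- real r * c * ln x + (c - real r * d)) / x ^ Suc r"
      using assms by (cases r) (auto simp: field_simps)
    ultimately show ?thesis by simp
  qed
  then show ?thesis by (simp add: ln_pow_def[abs_def] cd r_def)
qed

lemma ln_pow_tendsto_0:
  assumes "q \<ge> 1"
  shows "(ln_pow a b q k \<longlongrightarrow> 0) at_top"
proof -
  define r where "r = q + k"
  have r: "r \<ge> 1" using assms by (simp add: r_def)
  obtain c d where cd: "ln_pow_coeffs a b q k = (c, d)" by fastforce
  have i: "((\<lambda>x::real. inverse x) \<longlongrightarrow> 0) at_top"
    by (intro tendsto_inverse_0_at_top filterlim_ident)
  have "((\<lambda>x. (c * (ln x / x) + d * inverse x) * inverse x ^ (r - 1)) \<longlongrightarrow>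
      (c * 0 + d * 0) * 0 ^ (r - 1)) at_top"
    by (intro tendsto_intros ln_x_over_x_tendsto_0 i)
  moreover have "(c * (ln x / x) + d * inverse x) * inverse x ^ (r - 1) = (c * ln x + d) / x ^ r" for x :: real
    using r by (cases r) (auto simp: field_simps power_inverse divide_simps)
  ultimately show ?thesis by (simp add: ln_pow_def[abs_def] cd r_def)
qed

text \<open>The numerator of the ninth function is affine in ln x with nonnegative slope, so its
  sign on the whole half-line is settled by its value at M.\<close>

lemma ln_pow_tail:
  fixes M q :: nat
  assumes q: "q \<ge> 1" and M: "M > 0"
    and pos: "fst (ln_pow_coeffs a b q 9) \<ge> 0"
      "fst (ln_pow_coeffs a b q 9) * ln M + snd (ln_pow_coeffs a b q 9) \<ge> 0"
    and sums: "h sums S" and h: "\<And>n. n \<ge> M \<Longrightarrow> h n = ln_pow a b q 1 (real n)"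
  shows "\<bar>S - (\<Sum>n<M. h n) - euler_maclaurin_8 (ln_pow a b q) M\<bar> \<le> - ln_pow a b q 8 M / 604800"
proof (rule euler_maclaurin_8_tail[where h = h])
  fix x assume x: "real M \<le> x"
  have "ln M \<le> ln x" using x M by simp
  then have "fst (ln_pow_coeffs a b q 9) * ln M \<le> fst (ln_pow_coeffs a b q 9) * ln x"
    by (intro mult_left_mono pos)
  then show "0 \<le> ln_pow a b q 9 x"
    using pos x by (auto simp: ln_pow_def intro!: divide_nonneg_nonneg)
  show "(ln_pow a b q k has_real_derivative ln_pow a b q (Suc k) x) (at x)" for k
    using x M by (intro ln_pow_has_derivative) auto
qed (use q ln_pow_tendsto_0 sums h in auto)

section \<open>Logarithms of small primes\<close>

text \<open>ln ((N + 1)/N) = 2 artanh (1/(2N + 1)). Six terms of the odd power series are kept, and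
  the tail from y^13 on is dominated by a geometric series with ratio y^2.\<close>

lemma ln_add_one_bounds:
  fixes N :: real
  assumes "N > 0"
  defines "y \<equiv> 1 / (2 * N + 1)"
  defines "S \<equiv> 2 * (y + y^3 / 3 + y^5 / 5 + y^7 / 7 + y^9 / 9 + y^11 / 11)"
  shows "S \<le> ln (N + 1) - ln N" "ln (N + 1) - ln N \<le> S + 2 * (y^13 / (1 - y^2) / 13)"
proof -
  define x where "x = (N + 1) / N"
  have x: "x > 1" using assms by (simp add: x_def)
  have y: "y = (x - 1) / (x + 1)" using assms by (simp add: x_def y_def field_simps)
  have l: "ln x = ln (N + 1) - ln N" using assms by (simp add: x_def ln_div)
  have S: "S = (\<Sum>k<6. 2*y^(2*k+1) / real (2*k+1))"
    by (simp add: S_def eval_nat_numeral algebra_simps)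
  show "S \<le> ln (N + 1) - ln N" "ln (N + 1) - ln N \<le> S + 2 * (y^13 / (1 - y^2) / 13)"
    using ln_approx_bounds[OF x, of 6] unfolding y[symmetric] S[symmetric] l by simp_all
qed

lemma ln_composite_le_30:
  "ln (4::real) = 2 * ln 2"
  "ln (6::real) = ln 2 + ln 3"
  "ln (8::real) = 3 * ln 2"
  "ln (9::real) = 2 * ln 3"
  "ln (10::real) = ln 2 + ln 5"
  "ln (12::real) = 2 * ln 2 + ln 3"
  "ln (14::real) = ln 2 + ln 7"
  "ln (15::real) = ln 3 + ln 5"
  "ln (16::real) = 4 * ln 2"
  "ln (18::real) = ln 2 + 2 * ln 3"
  "ln (20::real) = 2 * ln 2 + ln 5"
  "ln (21::real) = ln 3 + ln 7"
  "ln (22::real) = ln 2 + ln 11"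
  "ln (24::real) = 3 * ln 2 + ln 3"
  "ln (25::real) = 2 * ln 5"
  "ln (26::real) = ln 2 + ln 13"
  "ln (27::real) = 3 * ln 3"
  "ln (28::real) = 2 * ln 2 + ln 7"
  "ln (30::real) = ln 2 + ln 3 + ln 5"
  using ln_mult[of "2::real" 2] ln_mult[of "2::real" 3] ln_mult[of "2::real" 4] ln_mult[of "3::real" 3]
    ln_mult[of "2::real" 5] ln_mult[of "2::real" 6] ln_mult[of "2::real" 7] ln_mult[of "3::real" 5]
    ln_mult[of "2::real" 8] ln_mult[of "2::real" 9] ln_mult[of "2::real" 10] ln_mult[of "3::real" 7]
    ln_mult[of "2::real" 11] ln_mult[of "2::real" 12] ln_mult[of "5::real" 5] ln_mult[of "2::real" 13]
    ln_mult[of "3::real" 9] ln_mult[of "2::real" 14] ln_mult[of "2::real" 15]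
  by simp_all

text \<open>The logarithms of 2, 3 and 5 are determined by those of 16/15, 25/24 and 81/80; for each further
  prime \<open>p\<close> in the list, \<open>p^2 - 1\<close> has only smaller prime factors in the list.\<close>

lemma ln_prime_bounds:
  "ln (2::real) \<in> {0.693147180559945307..0.693147180559945312}"
  "ln (3::real) \<in> {1.098612288668109689..1.098612288668109694}"
  "ln (5::real) \<in> {1.609437912434100372..1.609437912434100377}"
  "ln (7::real) \<in> {1.94591014905531328..1.94591014905531333}"
  "ln (11::real) \<in> {2.39789527279837052..2.39789527279837057}"
  "ln (13::real) \<in> {2.5649493574615365..2.5649493574615370}"
  "ln (17::real) \<in> {2.8332133440562158..2.8332133440562163}"
  "ln (19::real) \<in> {2.9444389791664402..2.9444389791664407}"
  "ln (23::real) \<in> {3.1354942159291494..3.1354942159291499}"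
  "ln (29::real) \<in> {3.3672958299864738..3.3672958299864743}"
proof -
  have b15: "ln 16 - ln 15 \<in> {0.06453852113757117166..(0.06453852113757117169::real)}"
    using ln_add_one_bounds[of 15] by (simp add: power_divide)
  have b24: "ln 25 - ln 24 \<in> {0.04082199452025512954..(0.04082199452025512957::real)}"
    using ln_add_one_bounds[of 24] by (simp add: power_divide)
  have b80: "ln 81 - ln 80 \<in> {0.01242251999855715330..(0.01242251999855715333::real)}"
    using ln_add_one_bounds[of 80] by (simp add: power_divide)
  have b48: "ln 49 - ln 48 \<in> {0.02061928720273568113..(0.02061928720273568116::real)}"
    using ln_add_one_bounds[of 48] by (simp add: power_divide)
  have b120: "ln 121 - ln 120 \<in> {0.00829880281469509386..(0.00829880281469509389::real)}"
    using ln_add_one_bounds[of 120] by (simp add: power_divide)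
  have b168: "ln 169 - ln 168 \<in> {0.00593473551981454734..(0.00593473551981454737::real)}"
    using ln_add_one_bounds[of 168] by (simp add: power_divide)
  have b288: "ln 289 - ln 288 \<in> {0.00346620797648623061..(0.00346620797648623064::real)}"
    using ln_add_one_bounds[of 288] by (simp add: power_divide)
  have b360: "ln 361 - ln 360 \<in> {0.00277392688272523436..(0.00277392688272523439::real)}"
    using ln_add_one_bounds[of 360] by (simp add: power_divide)
  have b528: "ln 529 - ln 528 \<in> {0.00189214815203790847..(0.00189214815203790850::real)}"
    using ln_add_one_bounds[of 528] by (simp add: power_divide)
  have b840: "ln 841 - ln 840 \<in> {0.00118976813558875500..(0.00118976813558875503::real)}"
    using ln_add_one_bounds[of 840] by (simp add: power_divide)
  note composite = ln_composite_le_30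
  have m80: "ln (80::real) = 4 * ln 2 + ln 5"
    using ln_mult[of "20::real" 4] composite by simp
  have m81: "ln (81::real) = 4 * ln 3"
    using ln_mult[of "27::real" 3] composite by simp
  have m48: "ln (48::real) = 4 * ln 2 + ln 3"
    using ln_mult[of "24::real" 2] composite by simp
  have m49: "ln (49::real) = 2 * ln 7"
    using ln_mult[of "7::real" 7] composite by simp
  have m120: "ln (120::real) = 3 * ln 2 + ln 3 + ln 5"
    using ln_mult[of "30::real" 4] composite by simp
  have m121: "ln (121::real) = 2 * ln 11"
    using ln_mult[of "11::real" 11] composite by simp
  have m168: "ln (168::real) = 3 * ln 2 + ln 3 + ln 7"
    using ln_mult[of "28::real" 6] composite by simp
  have m169: "ln (169::real) = 2 * ln 13"
    using ln_mult[of "13::real" 13] composite by simp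
  have m288: "ln (288::real) = 5 * ln 2 + 2 * ln 3"
    using ln_mult[of "24::real" 12] composite by simp
  have m289: "ln (289::real) = 2 * ln 17"
    using ln_mult[of "17::real" 17] composite by simp
  have m360: "ln (360::real) = 3 * ln 2 + 2 * ln 3 + ln 5"
    using ln_mult[of "30::real" 12] composite by simp
  have m361: "ln (361::real) = 2 * ln 19"
    using ln_mult[of "19::real" 19] composite by simp
  have m528: "ln (528::real) = 4 * ln 2 + ln 3 + ln 11"
    using ln_mult[of "24::real" 22] composite by simp
  have m529: "ln (529::real) = 2 * ln 23"
    using ln_mult[of "23::real" 23] composite by simp
  have m840: "ln (840::real) = 3 * ln 2 + ln 3 + ln 5 + ln 7"
    using ln_mult[of "30::real" 28] composite by simp
  have m841: "ln (841::real) = 2 * ln 29"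
    using ln_mult[of "29::real" 29] composite by simp
  \<comment> \<open>The exponent vectors of 16/15, 25/24 and 81/80 over 2, 3, 5 have determinant -1,
    so the three logarithms are small integer combinations of the enclosures; for instance ln 2 has
    the coefficients 7, 5, 3.\<close>
  show p2: "ln (2::real) \<in> {0.693147180559945307..0.693147180559945312}"
    using b15 b24 b80 m80 m81 composite by simp
  show p3: "ln (3::real) \<in> {1.098612288668109689..1.098612288668109694}"
    using b15 b24 b80 m80 m81 composite by simp
  show p5: "ln (5::real) \<in> {1.609437912434100372..1.609437912434100377}"
    using b15 b24 b80 m80 m81 composite by simp
  show p7: "ln (7::real) \<in> {1.94591014905531328..1.94591014905531333}"
    using b48 m48 m49 p2 p3 by simp
  show p11: "ln (11::real) \<in> {2.39789527279837052..2.39789527279837057}"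
    using b120 m120 m121 p2 p3 p5 by simp
  show p13: "ln (13::real) \<in> {2.5649493574615365..2.5649493574615370}"
    using b168 m168 m169 p2 p3 p7 by simp
  show p17: "ln (17::real) \<in> {2.8332133440562158..2.8332133440562163}"
    using b288 m288 m289 p2 p3 by simp
  show p19: "ln (19::real) \<in> {2.9444389791664402..2.9444389791664407}"
    using b360 m360 m361 p2 p3 p5 by simp
  show p23: "ln (23::real) \<in> {3.1354942159291494..3.1354942159291499}"
    using b528 m528 m529 p2 p3 p11 by simp
  show p29: "ln (29::real) \<in> {3.3672958299864738..3.3672958299864743}"
    using b840 m840 m841 p2 p3 p5 p7 by simp
qed

section \<open>Values of zeta and its derivative\<close>

lemmas ln_prime_lower = ln_prime_bounds[unfolded atLeastAtMost_iff, THEN conjunct1]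
lemmas ln_prime_upper = ln_prime_bounds[unfolded atLeastAtMost_iff, THEN conjunct2]

text \<open>Splits a numerical enclosure into three independent checks: the partial sum below 30,
  the Euler-Maclaurin correction at 30, and the remainder.\<close>

lemma ln_pow_series_interval:
  fixes h :: "nat \<Rightarrow> real"
  assumes coeff: "fst (ln_pow_coeffs a b q 9) \<ge> 0"
      "fst (ln_pow_coeffs a b q 9) * ln 30 + snd (ln_pow_coeffs a b q 9) \<ge> 0"
    and h: "\<And>n. h n = ln_pow a b q 1 (real n)"
    and partial: "(\<Sum>n<30. h n) \<in> {x..x2}"
    and em: "euler_maclaurin_8 (ln_pow a b q) 30 \<in> {y..y2}"
    and err: "- ln_pow a b q 8 30 / 604800 \<le> e"
    and sums: "h sums S" and q: "q \<ge> 1" and bounds: "l \<le> x + y - e" "x2 + y2 + e \<le> u"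
  shows "S \<in> {l..u}"
  using ln_pow_tail[OF q _ _ _ sums, of 30 a b] coeff h partial em err bounds
  by (simp add: abs_le_iff)

text \<open>The antiderivative of x^(-k) is -1/(k-1) x^(-(k-1)), which gives the parameters a = 0, b
  = -1/(k-1), q = k - 1. The orders listed in \<open>c\<close> are those in the correction (up to 6)
  and in the remainder (8 and 9).\<close>

lemma zeta_sum_2_bounds: "zeta_sum 2 \<in> {1.644934066848223..1.644934066848233}"
proof (rule ln_pow_series_interval)
  have c: "ln_pow_coeffs 0 (-1) 1 0 = (0, -1)"
    "ln_pow_coeffs 0 (-1) 1 1 = (0, 1)"
    "ln_pow_coeffs 0 (-1) 1 2 = (0, -2)"
    "ln_pow_coeffs 0 (-1) 1 4 = (0, -24)"
    "ln_pow_coeffs 0 (-1) 1 6 = (0, -720)"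
    "ln_pow_coeffs 0 (-1) 1 8 = (0, -40320)"
    "ln_pow_coeffs 0 (-1) 1 9 = (0, 362880)"
    by (simp_all add: eval_nat_numeral)
  show "fst (ln_pow_coeffs 0 (-1) 1 9) \<ge> 0" unfolding c by simp
  show "fst (ln_pow_coeffs 0 (-1) 1 9) * ln 30 + snd (ln_pow_coeffs 0 (-1) 1 9) \<ge> 0"
    unfolding c using ln_prime_lower by (simp add: ln_composite_le_30)
  show "1 / real n ^ 2 = ln_pow 0 (-1) 1 1 (real n)" for n
    unfolding ln_pow_def c by (simp add: power2_eq_square)
  show "(\<Sum>n<30. 1 / real n ^ 2) \<in> {1.61103900649048649..1.61103900649048650}"
    by (simp add: lessThan_nat_numeral lessThan_Suc)
  show "euler_maclaurin_8 (ln_pow 0 (-1) 1) 30 \<in> {0.03389506035774153..0.03389506035774174}"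
    unfolding atLeastAtMost_iff euler_maclaurin_8_def ln_pow_def c using ln_prime_lower ln_prime_upper
    by (intro conjI) (simp_all add: ln_composite_le_30 add_divide_distrib diff_divide_distrib)
  show "- ln_pow 0 (-1) 1 8 30 / 604800 \<le> 0.0000000000000034"
    unfolding ln_pow_def c using ln_prime_lower ln_prime_upper
    by (simp add: ln_composite_le_30 add_divide_distrib diff_divide_distrib)
qed (simp_all add: zeta_sum_sums)

text \<open>Integration by parts of ln x / x^k gives a = -1/(k-1), b = -1/(k-1)^2, q = k -
  1.\<close>

lemma zeta_ln_sum_2_bounds: "zeta_ln_sum 2 \<in> {0.937548254315839..0.937548254315854}"
proof (rule ln_pow_series_interval)
  have c: "ln_pow_coeffs (-1) (-1) 1 0 = (-1, -1)"
    "ln_pow_coeffs (-1) (-1) 1 1 = (1, 0)"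
    "ln_pow_coeffs (-1) (-1) 1 2 = (-2, 1)"
    "ln_pow_coeffs (-1) (-1) 1 4 = (-24, 26)"
    "ln_pow_coeffs (-1) (-1) 1 6 = (-720, 1044)"
    "ln_pow_coeffs (-1) (-1) 1 8 = (-40320, 69264)"
    "ln_pow_coeffs (-1) (-1) 1 9 = (362880, -663696)"
    by (simp_all add: eval_nat_numeral)
  show "fst (ln_pow_coeffs (-1) (-1) 1 9) \<ge> 0" unfolding c by simp
  show "fst (ln_pow_coeffs (-1) (-1) 1 9) * ln 30 + snd (ln_pow_coeffs (-1) (-1) 1 9) \<ge> 0"
    unfolding c using ln_prime_lower by (simp add: ln_composite_le_30)
  show "ln (real n) / real n ^ 2 = ln_pow (-1) (-1) 1 1 (real n)" for n
    unfolding ln_pow_def c by (simp add: power2_eq_square)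
  show "(\<Sum>n<30. ln (real n) / real n ^ 2) \<in> {0.78893421537775922..0.78893421537775963}"
    unfolding atLeastAtMost_iff using ln_prime_lower ln_prime_upper
    by (intro conjI)
      (simp_all add: lessThan_nat_numeral lessThan_Suc ln_composite_le_30 add_divide_distrib)
  show "euler_maclaurin_8 (ln_pow (-1) (-1) 1) 30 \<in> {0.14861403893808707..0.14861403893808728}"
    unfolding atLeastAtMost_iff euler_maclaurin_8_def ln_pow_def c using ln_prime_lower ln_prime_upper
    by (intro conjI) (simp_all add: ln_composite_le_30 add_divide_distrib diff_divide_distrib)
  show "- ln_pow (-1) (-1) 1 8 30 / 604800 \<le> 0.0000000000000058"
    unfolding ln_pow_def c using ln_prime_lower ln_prime_upper
    by (simp add: ln_composite_le_30 add_divide_distrib diff_divide_distrib)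
qed (simp_all add: zeta_ln_sum_sums)

lemma zeta_sum_3_bounds: "zeta_sum 3 \<in> {1.202056903159592..1.202056903159597}"
proof (rule ln_pow_series_interval)
  have c: "ln_pow_coeffs 0 (-1 / 2) 2 0 = (0, -1 / 2)"
    "ln_pow_coeffs 0 (-1 / 2) 2 1 = (0, 1)"
    "ln_pow_coeffs 0 (-1 / 2) 2 2 = (0, -3)"
    "ln_pow_coeffs 0 (-1 / 2) 2 4 = (0, -60)"
    "ln_pow_coeffs 0 (-1 / 2) 2 6 = (0, -2520)"
    "ln_pow_coeffs 0 (-1 / 2) 2 8 = (0, -181440)"
    "ln_pow_coeffs 0 (-1 / 2) 2 9 = (0, 1814400)"
    by (simp_all add: eval_nat_numeral)
  show "fst (ln_pow_coeffs 0 (-1 / 2) 2 9) \<ge> 0" unfolding c by simp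
  show "fst (ln_pow_coeffs 0 (-1 / 2) 2 9) * ln 30 + snd (ln_pow_coeffs 0 (-1 / 2) 2 9) \<ge> 0"
    unfolding c using ln_prime_lower by (simp add: ln_composite_le_30)
  show "1 / real n ^ 3 = ln_pow 0 (-1 / 2) 2 1 (real n)" for n
    unfolding ln_pow_def c by (simp add: power2_eq_square)
  show "(\<Sum>n<30. 1 / real n ^ 3) \<in> {1.20148252055772998..1.20148252055772999}"
    by (simp add: lessThan_nat_numeral lessThan_Suc)
  show "euler_maclaurin_8 (ln_pow 0 (-1 / 2) 2) 30 \<in> {0.00057438260186445..0.00057438260186466}"
    unfolding atLeastAtMost_iff euler_maclaurin_8_def ln_pow_def c using ln_prime_lower ln_prime_upper
    by (intro conjI) (simp_all add: ln_composite_le_30 add_divide_distrib diff_divide_distrib)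
  show "- ln_pow 0 (-1 / 2) 2 8 30 / 604800 \<le> 0.0000000000000006"
    unfolding ln_pow_def c using ln_prime_lower ln_prime_upper
    by (simp add: ln_composite_le_30 add_divide_distrib diff_divide_distrib)
qed (simp_all add: zeta_sum_sums)

lemma zeta_ln_sum_3_bounds: "zeta_ln_sum 3 \<in> {0.198126242885635..0.198126242885640}"
proof (rule ln_pow_series_interval)
  have c: "ln_pow_coeffs (-1 / 2) (-1 / 4) 2 0 = (-1 / 2, -1 / 4)"
    "ln_pow_coeffs (-1 / 2) (-1 / 4) 2 1 = (1, 0)"
    "ln_pow_coeffs (-1 / 2) (-1 / 4) 2 2 = (-3, 1)"
    "ln_pow_coeffs (-1 / 2) (-1 / 4) 2 4 = (-60, 47)"
    "ln_pow_coeffs (-1 / 2) (-1 / 4) 2 6 = (-2520, 2754)"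
    "ln_pow_coeffs (-1 / 2) (-1 / 4) 2 8 = (-181440, 241128)"
    "ln_pow_coeffs (-1 / 2) (-1 / 4) 2 9 = (1814400, -2592720)"
    by (simp_all add: eval_nat_numeral)
  show "fst (ln_pow_coeffs (-1 / 2) (-1 / 4) 2 9) \<ge> 0" unfolding c by simp
  show "fst (ln_pow_coeffs (-1 / 2) (-1 / 4) 2 9) * ln 30 + snd (ln_pow_coeffs (-1 / 2) (-1 / 4) 2 9) \<ge> 0"
    unfolding c using ln_prime_lower by (simp add: ln_composite_le_30)
  show "ln (real n) / real n ^ 3 = ln_pow (-1 / 2) (-1 / 4) 2 1 (real n)" for n
    unfolding ln_pow_def c by (simp add: power2_eq_square)
  show "(\<Sum>n<30. ln (real n) / real n ^ 3) \<in> {0.19589497929757835..0.19589497929757876}"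
    unfolding atLeastAtMost_iff using ln_prime_lower ln_prime_upper
    by (intro conjI)
      (simp_all add: lessThan_nat_numeral lessThan_Suc ln_composite_le_30 add_divide_distrib)
  show "euler_maclaurin_8 (ln_pow (-1 / 2) (-1 / 4) 2) 30 \<in> {0.00223126358805872..0.00223126358805893}"
    unfolding atLeastAtMost_iff euler_maclaurin_8_def ln_pow_def c using ln_prime_lower ln_prime_upper
    by (intro conjI) (simp_all add: ln_composite_le_30 add_divide_distrib diff_divide_distrib)
  show "- ln_pow (-1 / 2) (-1 / 4) 2 8 30 / 604800 \<le> 0.0000000000000011"
    unfolding ln_pow_def c using ln_prime_lower ln_prime_upper
    by (simp add: ln_composite_le_30 add_divide_distrib diff_divide_distrib)
qed (simp_all add: zeta_ln_sum_sums)

lemma zeta_sum_5_bounds: "zeta_sum 5 \<in> {1.036927755143368..1.036927755143372}"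
proof (rule ln_pow_series_interval)
  have c: "ln_pow_coeffs 0 (-1 / 4) 4 0 = (0, -1 / 4)"
    "ln_pow_coeffs 0 (-1 / 4) 4 1 = (0, 1)"
    "ln_pow_coeffs 0 (-1 / 4) 4 2 = (0, -5)"
    "ln_pow_coeffs 0 (-1 / 4) 4 4 = (0, -210)"
    "ln_pow_coeffs 0 (-1 / 4) 4 6 = (0, -15120)"
    "ln_pow_coeffs 0 (-1 / 4) 4 8 = (0, -1663200)"
    "ln_pow_coeffs 0 (-1 / 4) 4 9 = (0, 19958400)"
    by (simp_all add: eval_nat_numeral)
  show "fst (ln_pow_coeffs 0 (-1 / 4) 4 9) \<ge> 0" unfolding c by simp
  show "fst (ln_pow_coeffs 0 (-1 / 4) 4 9) * ln 30 + snd (ln_pow_coeffs 0 (-1 / 4) 4 9) \<ge> 0"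
    unfolding c using ln_prime_lower by (simp add: ln_composite_le_30)
  show "1 / real n ^ 5 = ln_pow 0 (-1 / 4) 4 1 (real n)" for n
    unfolding ln_pow_def c by (simp add: power2_eq_square)
  show "(\<Sum>n<30. 1 / real n ^ 5) \<in> {1.03692742535414741..1.03692742535414742}"
    by (simp add: lessThan_nat_numeral lessThan_Suc)
  show "euler_maclaurin_8 (ln_pow 0 (-1 / 4) 4) 30 \<in> {0.00000032978922241..0.00000032978922262}"
    unfolding atLeastAtMost_iff euler_maclaurin_8_def ln_pow_def c using ln_prime_lower ln_prime_upper
    by (intro conjI) (simp_all add: ln_composite_le_30 add_divide_distrib diff_divide_distrib)
  \<comment> \<open>The true value is about 5 * 10^(-18); from k = 5 on the remainder is simply
    rounded up to 10^(-16).\<close>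
  show "- ln_pow 0 (-1 / 4) 4 8 30 / 604800 \<le> 0.0000000000000001"
    unfolding ln_pow_def c using ln_prime_lower ln_prime_upper
    by (simp add: ln_composite_le_30 add_divide_distrib diff_divide_distrib)
qed (simp_all add: zeta_sum_sums)

lemma zeta_ln_sum_5_bounds: "zeta_ln_sum 5 \<in> {0.028573780509461..0.028573780509465}"
proof (rule ln_pow_series_interval)
  have c: "ln_pow_coeffs (-1 / 4) (-1 / 16) 4 0 = (-1 / 4, -1 / 16)"
    "ln_pow_coeffs (-1 / 4) (-1 / 16) 4 1 = (1, 0)"
    "ln_pow_coeffs (-1 / 4) (-1 / 16) 4 2 = (-5, 1)"
    "ln_pow_coeffs (-1 / 4) (-1 / 16) 4 4 = (-210, 107)"
    "ln_pow_coeffs (-1 / 4) (-1 / 16) 4 6 = (-15120, 11274)"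
    "ln_pow_coeffs (-1 / 4) (-1 / 16) 4 8 = (-1663200, 1557660)"
    "ln_pow_coeffs (-1 / 4) (-1 / 16) 4 9 = (19958400, -20355120)"
    by (simp_all add: eval_nat_numeral)
  show "fst (ln_pow_coeffs (-1 / 4) (-1 / 16) 4 9) \<ge> 0" unfolding c by simp
  show "fst (ln_pow_coeffs (-1 / 4) (-1 / 16) 4 9) * ln 30 + snd (ln_pow_coeffs (-1 / 4) (-1 / 16) 4 9) \<ge> 0"
    unfolding c using ln_prime_lower by (simp add: ln_composite_le_30)
  show "ln (real n) / real n ^ 5 = ln_pow (-1 / 4) (-1 / 16) 4 1 (real n)" for n
    unfolding ln_pow_def c by (simp add: power2_eq_square)
  show "(\<Sum>n<30. ln (real n) / real n ^ 5) \<in> {0.02857258178481479..0.02857258178481520}"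
    unfolding atLeastAtMost_iff using ln_prime_lower ln_prime_upper
    by (intro conjI)
      (simp_all add: lessThan_nat_numeral lessThan_Suc ln_composite_le_30 add_divide_distrib)
  show "euler_maclaurin_8 (ln_pow (-1 / 4) (-1 / 16) 4) 30 \<in> {0.00000119872464786..0.00000119872464807}"
    unfolding atLeastAtMost_iff euler_maclaurin_8_def ln_pow_def c using ln_prime_lower ln_prime_upper
    by (intro conjI) (simp_all add: ln_composite_le_30 add_divide_distrib diff_divide_distrib)
  show "- ln_pow (-1 / 4) (-1 / 16) 4 8 30 / 604800 \<le> 0.0000000000000001"
    unfolding ln_pow_def c using ln_prime_lower ln_prime_upper
    by (simp add: ln_composite_le_30 add_divide_distrib diff_divide_distrib)
qed (simp_all add: zeta_ln_sum_sums)

lemma zeta_sum_6_bounds: "zeta_sum 6 \<in> {1.017343061984448..1.017343061984451}"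
proof (rule ln_pow_series_interval)
  have c: "ln_pow_coeffs 0 (-1 / 5) 5 0 = (0, -1 / 5)"
    "ln_pow_coeffs 0 (-1 / 5) 5 1 = (0, 1)"
    "ln_pow_coeffs 0 (-1 / 5) 5 2 = (0, -6)"
    "ln_pow_coeffs 0 (-1 / 5) 5 4 = (0, -336)"
    "ln_pow_coeffs 0 (-1 / 5) 5 6 = (0, -30240)"
    "ln_pow_coeffs 0 (-1 / 5) 5 8 = (0, -3991680)"
    "ln_pow_coeffs 0 (-1 / 5) 5 9 = (0, 51891840)"
    by (simp_all add: eval_nat_numeral)
  show "fst (ln_pow_coeffs 0 (-1 / 5) 5 9) \<ge> 0" unfolding c by simp
  show "fst (ln_pow_coeffs 0 (-1 / 5) 5 9) * ln 30 + snd (ln_pow_coeffs 0 (-1 / 5) 5 9) \<ge> 0"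
    unfolding c using ln_prime_lower by (simp add: ln_composite_le_30)
  show "1 / real n ^ 6 = ln_pow 0 (-1 / 5) 5 1 (real n)" for n
    unfolding ln_pow_def c by (simp add: power2_eq_square)
  show "(\<Sum>n<30. 1 / real n ^ 6) \<in> {1.01734305304528669..1.01734305304528670}"
    by (simp add: lessThan_nat_numeral lessThan_Suc)
  show "euler_maclaurin_8 (ln_pow 0 (-1 / 5) 5) 30 \<in> {0.00000000893916234..0.00000000893916255}"
    unfolding atLeastAtMost_iff euler_maclaurin_8_def ln_pow_def c using ln_prime_lower ln_prime_upper
    by (intro conjI) (simp_all add: ln_composite_le_30 add_divide_distrib diff_divide_distrib)
  show "- ln_pow 0 (-1 / 5) 5 8 30 / 604800 \<le> 0.0000000000000001"
    unfolding ln_pow_def c using ln_prime_lower ln_prime_upper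
    by (simp add: ln_composite_le_30 add_divide_distrib diff_divide_distrib)
qed (simp_all add: zeta_sum_sums)

lemma zeta_ln_sum_6_bounds: "zeta_ln_sum 6 \<in> {0.012852165131794..0.012852165131797}"
proof (rule ln_pow_series_interval)
  have c: "ln_pow_coeffs (-1 / 5) (-1 / 25) 5 0 = (-1 / 5, -1 / 25)"
    "ln_pow_coeffs (-1 / 5) (-1 / 25) 5 1 = (1, 0)"
    "ln_pow_coeffs (-1 / 5) (-1 / 25) 5 2 = (-6, 1)"
    "ln_pow_coeffs (-1 / 5) (-1 / 25) 5 4 = (-336, 146)"
    "ln_pow_coeffs (-1 / 5) (-1 / 25) 5 6 = (-30240, 19524)"
    "ln_pow_coeffs (-1 / 5) (-1 / 25) 5 8 = (-3991680, 3272688)"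
    "ln_pow_coeffs (-1 / 5) (-1 / 25) 5 9 = (51891840, -46536624)"
    by (simp_all add: eval_nat_numeral)
  show "fst (ln_pow_coeffs (-1 / 5) (-1 / 25) 5 9) \<ge> 0" unfolding c by simp
  show "fst (ln_pow_coeffs (-1 / 5) (-1 / 25) 5 9) * ln 30 + snd (ln_pow_coeffs (-1 / 5) (-1 / 25) 5 9) \<ge> 0"
    unfolding c using ln_prime_lower by (simp add: ln_composite_le_30)
  show "ln (real n) / real n ^ 6 = ln_pow (-1 / 5) (-1 / 25) 5 1 (real n)" for n
    unfolding ln_pow_def c by (simp add: power2_eq_square)
  show "(\<Sum>n<30. ln (real n) / real n ^ 6) \<in> {0.01285213308564921..0.01285213308564962}"
    unfolding atLeastAtMost_iff using ln_prime_lower ln_prime_upper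
    by (intro conjI)
      (simp_all add: lessThan_nat_numeral lessThan_Suc ln_composite_le_30 add_divide_distrib)
  show "euler_maclaurin_8 (ln_pow (-1 / 5) (-1 / 25) 5) 30 \<in> {0.00000003204614621..0.00000003204614642}"
    unfolding atLeastAtMost_iff euler_maclaurin_8_def ln_pow_def c using ln_prime_lower ln_prime_upper
    by (intro conjI) (simp_all add: ln_composite_le_30 add_divide_distrib diff_divide_distrib)
  show "- ln_pow (-1 / 5) (-1 / 25) 5 8 30 / 604800 \<le> 0.0000000000000001"
    unfolding ln_pow_def c using ln_prime_lower ln_prime_upper
    by (simp add: ln_composite_le_30 add_divide_distrib diff_divide_distrib)
qed (simp_all add: zeta_ln_sum_sums)

lemma zeta_sum_7_bounds: "zeta_sum 7 \<in> {1.008349277381921..1.008349277381924}"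
proof (rule ln_pow_series_interval)
  have c: "ln_pow_coeffs 0 (-1 / 6) 6 0 = (0, -1 / 6)"
    "ln_pow_coeffs 0 (-1 / 6) 6 1 = (0, 1)"
    "ln_pow_coeffs 0 (-1 / 6) 6 2 = (0, -7)"
    "ln_pow_coeffs 0 (-1 / 6) 6 4 = (0, -504)"
    "ln_pow_coeffs 0 (-1 / 6) 6 6 = (0, -55440)"
    "ln_pow_coeffs 0 (-1 / 6) 6 8 = (0, -8648640)"
    "ln_pow_coeffs 0 (-1 / 6) 6 9 = (0, 121080960)"
    by (simp_all add: eval_nat_numeral)
  show "fst (ln_pow_coeffs 0 (-1 / 6) 6 9) \<ge> 0" unfolding c by simp
  show "fst (ln_pow_coeffs 0 (-1 / 6) 6 9) * ln 30 + snd (ln_pow_coeffs 0 (-1 / 6) 6 9) \<ge> 0"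
    unfolding c using ln_prime_lower by (simp add: ln_composite_le_30)
  show "1 / real n ^ 7 = ln_pow 0 (-1 / 6) 6 1 (real n)" for n
    unfolding ln_pow_def c by (simp add: power2_eq_square)
  show "(\<Sum>n<30. 1 / real n ^ 7) \<in> {1.00834927712954886..1.00834927712954887}"
    by (simp add: lessThan_nat_numeral lessThan_Suc)
  show "euler_maclaurin_8 (ln_pow 0 (-1 / 6) 6) 30 \<in> {0.00000000025237386..0.00000000025237407}"
    unfolding atLeastAtMost_iff euler_maclaurin_8_def ln_pow_def c using ln_prime_lower ln_prime_upper
    by (intro conjI) (simp_all add: ln_composite_le_30 add_divide_distrib diff_divide_distrib)
  show "- ln_pow 0 (-1 / 6) 6 8 30 / 604800 \<le> 0.0000000000000001"
    unfolding ln_pow_def c using ln_prime_lower ln_prime_upper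
    by (simp add: ln_composite_le_30 add_divide_distrib diff_divide_distrib)
qed (simp_all add: zeta_sum_sums)

lemma zeta_ln_sum_7_bounds: "zeta_ln_sum 7 \<in> {0.006033516960874..0.006033516960877}"
proof (rule ln_pow_series_interval)
  have c: "ln_pow_coeffs (-1 / 6) (-1 / 36) 6 0 = (-1 / 6, -1 / 36)"
    "ln_pow_coeffs (-1 / 6) (-1 / 36) 6 1 = (1, 0)"
    "ln_pow_coeffs (-1 / 6) (-1 / 36) 6 2 = (-7, 1)"
    "ln_pow_coeffs (-1 / 6) (-1 / 36) 6 4 = (-504, 191)"
    "ln_pow_coeffs (-1 / 6) (-1 / 36) 6 6 = (-55440, 31594)"
    "ln_pow_coeffs (-1 / 6) (-1 / 36) 6 8 = (-8648640, 6314664)"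
    "ln_pow_coeffs (-1 / 6) (-1 / 36) 6 9 = (121080960, -97053936)"
    by (simp_all add: eval_nat_numeral)
  show "fst (ln_pow_coeffs (-1 / 6) (-1 / 36) 6 9) \<ge> 0" unfolding c by simp
  show "fst (ln_pow_coeffs (-1 / 6) (-1 / 36) 6 9) * ln 30 + snd (ln_pow_coeffs (-1 / 6) (-1 / 36) 6 9) \<ge> 0"
    unfolding c using ln_prime_lower by (simp add: ln_composite_le_30)
  show "ln (real n) / real n ^ 7 = ln_pow (-1 / 6) (-1 / 36) 6 1 (real n)" for n
    unfolding ln_pow_def c by (simp add: power2_eq_square)
  show "(\<Sum>n<30. ln (real n) / real n ^ 7) \<in> {0.00603351606452439..0.00603351606452480}"
    unfolding atLeastAtMost_iff using ln_prime_lower ln_prime_upper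
    by (intro conjI)
      (simp_all add: lessThan_nat_numeral lessThan_Suc ln_composite_le_30 add_divide_distrib)
  show "euler_maclaurin_8 (ln_pow (-1 / 6) (-1 / 36) 6) 30 \<in> {0.00000000089635094..0.00000000089635115}"
    unfolding atLeastAtMost_iff euler_maclaurin_8_def ln_pow_def c using ln_prime_lower ln_prime_upper
    by (intro conjI) (simp_all add: ln_composite_le_30 add_divide_distrib diff_divide_distrib)
  show "- ln_pow (-1 / 6) (-1 / 36) 6 8 30 / 604800 \<le> 0.0000000000000001"
    unfolding ln_pow_def c using ln_prime_lower ln_prime_upper
    by (simp add: ln_composite_le_30 add_divide_distrib diff_divide_distrib)
qed (simp_all add: zeta_ln_sum_sums)

section \<open>The value of kappa\<close>

text \<open>The conditions on l and u are cross-multiplied, so that they become comparisons of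
  products of decimals.\<close>

lemma interval_divide:
  fixes x y :: real
  assumes "x \<in> {a..a'}" "y \<in> {b..b'}" "0 \<le> l" "0 \<le> a" "0 < b" "l * b' \<le> a" "a' \<le> u * b"
  shows "x / y \<in> {l..u}"
proof -
  have y: "y > 0" using assms by auto
  have "l * y \<le> l * b'" using assms by (intro mult_left_mono) auto
  then have 1: "l \<le> x / y" using assms y by (simp add: le_divide_eq)
  have "0 \<le> u * b" using assms by auto
  then have "u \<ge> 0" using assms by (simp add: zero_le_mult_iff)
  then have "u * b \<le> u * y" using assms by (intro mult_left_mono) auto
  then have "x / y \<le> u" using assms y by (simp add: divide_le_eq)
  with 1 show ?thesis by simp
qed

text \<open>The part of \<open>1/(p(p-1))\<close> not captured by the \<open>Z(k)\<close>, of order \<open>p^(-10)\<close>.\<close>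

definition kappa_weight :: "real \<Rightarrow> real" where
  "kappa_weight x = 1 / (x * (x - 1)) -
    (1 / (x^2 - 1) + 1 / (x^3 - 1) + 1 / (x^5 - 1) - 1 / (x^6 - 1) + 1 / (x^7 - 1))"

text \<open>The geometric series in x^(-k), cut after n terms with exact remainder. It brings
  fractions with different k to a common order in 1/x.\<close>

lemma geometric_fraction:
  fixes x :: real
  assumes "x > 1" "k > 0"
  shows "1 / (x ^ k - 1) = (\<Sum>j<n. (1 / x) ^ (k * Suc j)) + (1 / x) ^ (k * Suc n) / (1 - (1 / x) ^ k)"
proof -
  define y where "y = (1 / x) ^ k"
  define z where "z = x ^ k"
  have z: "z > 1" using assms by (simp add: z_def)
  have yz: "y = 1 / z" by (simp add: y_def z_def power_one_over)
  have y: "y \<noteq> 1" "1 / (x ^ k - 1) = y / (1 - y)"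
    unfolding z_def[symmetric] using z by (auto simp: yz field_simps)
  have "(\<Sum>j<n. y * y ^ j) = y * ((1 - y ^ n) / (1 - y))"
    using y by (simp add: sum_gp_strict flip: sum_distrib_left)
  then have "(\<Sum>j<n. y ^ Suc j) + y ^ Suc n / (1 - y) = y / (1 - y)"
    using y by (simp add: field_simps)
  then show ?thesis unfolding y(2) power_mult y_def[symmetric] by simp
qed

text \<open>In powers of y = 1/x everything below y^10 cancels. The result is compared with 1/(x^7 -
  1) because the sum of ln p times that fraction over all primes is already known.\<close>

lemma kappa_weight_bound:
  fixes x :: real
  assumes x: "x \<ge> 31"
  shows "\<bar>kappa_weight x\<bar> \<le> 1 / 10000 * (1 / (x ^ 7 - 1))"
proof -
  define y where "y = 1 / x"
  have y: "0 < y" "y \<le> 1 / 31" using x by (auto simp: y_def field_simps)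
  define r where "r k = 1 / (1 - y ^ k)" for k :: nat
  have r: "1 \<le> r k" "r k \<le> 31 / 30" if "k \<ge> 1" for k
  proof -
    have "y ^ k \<le> y ^ 1" using y that by (intro power_decreasing) auto
    then have "y ^ k \<le> 1 / 31" "y ^ k > 0" using y by auto
    then show "1 \<le> r k" "r k \<le> 31 / 30" by (auto simp: r_def field_simps)
  qed
  have frac: "1 / (x ^ k - 1) = (\<Sum>j<n. y ^ (k * Suc j)) + y ^ (k * Suc n) * r k" if "k > 0" for k n
    using geometric_fraction[of x k n] x that by (simp add: y_def r_def)
  have "1 / (x * (x - 1)) = 1 / (x ^ 1 - 1) - y"
    using x by (simp add: y_def field_simps)
  also have "\<dots> = y^2 + y^3 + y^4 + y^5 + y^6 + y^7 + y^8 + y^9 + y^10 * r 1"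
    by (subst frac[of 1 9]) (simp_all add: eval_nat_numeral)
  finally have f1: "1 / (x * (x - 1)) = y^2 + y^3 + y^4 + y^5 + y^6 + y^7 + y^8 + y^9 + y^10 * r 1" .
  have f2: "1 / (x^2 - 1) = y^2 + y^4 + y^6 + y^8 + y^10 * r 2"
    by (subst frac[of 2 4]) (simp_all add: eval_nat_numeral)
  have f3: "1 / (x^3 - 1) = y^3 + y^6 + y^9 + y^12 * r 3"
    by (subst frac[of 3 3]) (simp_all add: eval_nat_numeral)
  have f5: "1 / (x^5 - 1) = y^5 + y^10 * r 5"
    by (subst frac[of 5 1]) (simp_all add: eval_nat_numeral)
  have f6: "1 / (x^6 - 1) = y^6 + y^12 * r 6"
    by (subst frac[of 6 1]) (simp_all add: eval_nat_numeral)
  have f7: "1 / (x^7 - 1) = y^7 + y^14 * r 7"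
    by (subst frac[of 7 1]) (simp_all add: eval_nat_numeral)
  have "kappa_weight x = y^10 * r 1 - y^10 * r 2 - y^12 * r 3 - y^10 * r 5 + y^12 * r 6 - y^14 * r 7"
    unfolding kappa_weight_def f1 f2 f3 f5 f6 f7 by simp
  also have "\<dots> = y^10 * (r 1 - r 2 - r 5 + y^2 * (r 6 - r 3) - y^4 * r 7)"
    by (simp add: algebra_simps flip: power_add)
  finally have eq: "kappa_weight x = y^10 * (r 1 - r 2 - r 5 + y^2 * (r 6 - r 3) - y^4 * r 7)" .
  have y2: "y^2 \<le> 1" "y^4 \<le> 1" using y by (auto intro!: power_le_one)
  have "\<bar>r 6 - r 3\<bar> \<le> 1 / 30" unfolding abs_le_iff using r[of 6] r[of 3] by simp
  then have "\<bar>y^2 * (r 6 - r 3)\<bar> \<le> 1 * (1/30)"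
    unfolding abs_mult using y2 by (intro mult_mono) auto
  moreover have "\<bar>y^4 * r 7\<bar> \<le> 1 * (31/30)"
    unfolding abs_mult using y2 r[of 7] by (intro mult_mono) auto
  \<comment> \<open>The first three terms contribute at most 32/30 in absolute value, the others
    1/30 and 31/30. The resulting 2.2 y^3 is below 1/10000 since y <= 1/31.\<close>
  ultimately have "\<bar>r 1 - r 2 - r 5 + y^2 * (r 6 - r 3) - y^4 * r 7\<bar> \<le> 2.2"
    unfolding abs_le_iff using r[of 1] r[of 2] r[of 5] by simp
  then have "\<bar>kappa_weight x\<bar> \<le> y^10 * 2.2"
    unfolding eq abs_mult using y by (intro mult_mono) auto
  also have "\<dots> = y^7 * (y^3 * 2.2)" by (simp flip: power_add)
  also have "\<dots> \<le> y^7 * ((1/31)^3 * 2.2)"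
    using y by (intro mult_left_mono mult_right_mono power_mono) auto
  also have "\<dots> \<le> y^7 * (1 / 10000)"
    using y by (intro mult_left_mono) (auto simp: power_divide)
  also have "y^7 \<le> 1 / (x^7 - 1)" unfolding f7 using y r[of 7] by simp
  finally show ?thesis by (simp add: mult.commute)
qed

lemma primes_less_30: "{p::nat. prime p \<and> p < 30} = {2, 3, 5, 7, 11, 13, 17, 19, 23, 29}"
proof -
  have "p \<in> {2, 3, 5, 7, 11, 13, 17, 19, 23, 29}" if "prime p" "p < 30" for p :: nat
  proof -
    have "p \<in> {..<30}" using that by simp
    then have "p \<in> {0, 1, 2, 3, 4, 5, 6, 7, 8, 9, 10, 11, 12, 13, 14, 15, 16, 17, 18, 19, 20,
        21, 22, 23, 24, 25, 26, 27, 28, 29}"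
      by (simp add: lessThan_nat_numeral lessThan_Suc) argo
    then show ?thesis using that(1) by (elim insertE) simp_all
  qed
  then show ?thesis by auto
qed

lemma has_sum_diff:
  fixes f g :: "'a \<Rightarrow> real"
  assumes "(f has_sum a) A" "(g has_sum b) A"
  shows "((\<lambda>x. f x - g x) has_sum a - b) A"
  using has_sum_add[OF assms(1) has_sum_uminusI[OF assms(2)]] by simp

text \<open>The primes below 30 are separated off. On the rest the termwise bound is summed by means
  of Z(7) itself, whose tail is its value minus the finite part.\<close>

lemma kappa_decomposition:
  defines "Z \<equiv> \<lambda>k. zeta_ln_sum k / zeta_sum k"
  shows "\<bar>kappa - (Z 2 + Z 3 + Z 5 - Z 6 + Z 7) -
      (\<Sum>p\<in>{p. prime p \<and> p < 30}. ln (real p) * kappa_weight (real p))\<bar>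
    \<le> 1 / 10000 * (Z 7 - (\<Sum>p\<in>{p. prime p \<and> p < 30}. ln (real p) / (real p ^ 7 - 1)))"
proof -
  define F where "F = {p::nat. prime p \<and> p < 30}"
  define f where "f p = ln (real p) * kappa_weight (real p)" for p :: nat
  define g where "g p = ln (real p) / (real p ^ 7 - 1)" for p :: nat
  have F: "finite F" "F \<subseteq> {p. prime p}" by (auto simp: F_def)
  have Z: "((\<lambda>p. ln (real p) / (real p ^ k - 1)) has_sum Z k) {p. prime p}" if "k \<ge> 2" for k
    unfolding Z_def using primes_zeta_log_derivative[OF that] .
  have "(kappa_term has_sum kappa) {p. prime p}"
    using kappa_term_summable_on by (simp add: kappa_def kappa_term_def[abs_def])
  then have "((\<lambda>p. kappa_term p - (ln (real p) / (real p ^ 2 - 1) + ln (real p) / (real p ^ 3 - 1)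
      + ln (real p) / (real p ^ 5 - 1) - ln (real p) / (real p ^ 6 - 1) + ln (real p) / (real p ^ 7 - 1)))
      has_sum kappa - (Z 2 + Z 3 + Z 5 - Z 6 + Z 7)) {p. prime p}"
    by (intro has_sum_diff has_sum_add Z) auto
  then have f: "(f has_sum kappa - (Z 2 + Z 3 + Z 5 - Z 6 + Z 7)) {p. prime p}"
    by (rule has_sum_cong[THEN iffD1, rotated])
      (simp add: f_def kappa_weight_def kappa_term_def right_diff_distrib distrib_left)
  have f': "(f has_sum kappa - (Z 2 + Z 3 + Z 5 - Z 6 + Z 7) - sum f F) ({p. prime p} - F)"
    by (rule has_sum_Diff[OF f _ F(2)]) (use F in auto)
  have "(g has_sum Z 7) {p. prime p}" unfolding g_def using Z[of 7] by simp
  then have "(g has_sum Z 7 - sum g F) ({p. prime p} - F)"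
    by (rule has_sum_Diff[OF _ _ F(2)]) (use F in auto)
  then have g': "((\<lambda>p. 1 / 10000 * g p) has_sum 1 / 10000 * (Z 7 - sum g F)) ({p. prime p} - F)"
    by (rule has_sum_cmult_right)
  have bound: "\<bar>f p\<bar> \<le> 1 / 10000 * g p" if "p \<in> {p. prime p} - F" for p
  proof -
    have p: "prime p" "p \<ge> 30" using that by (auto simp: F_def)
    \<comment> \<open>This closes the gap between p >= 30 and the bound 31 required by
      \<open>kappa_weight_bound\<close>.\<close>
    have "\<not> prime (30::nat)" by simp
    then have "p \<noteq> 30" using p by metis
    then have p31: "real p \<ge> 31" using p by simp
    have "\<bar>f p\<bar> = ln (real p) * \<bar>kappa_weight (real p)\<bar>" using p31 by (simp add: f_def abs_mult)
    also have "\<dots> \<le> ln (real p) * (1 / 10000 * (1 / (real p ^ 7 - 1)))"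
      using p31 by (intro mult_left_mono kappa_weight_bound) auto
    finally show ?thesis by (simp add: g_def)
  qed
  have "kappa - (Z 2 + Z 3 + Z 5 - Z 6 + Z 7) - sum f F \<le> 1 / 10000 * (Z 7 - sum g F)"
    by (rule has_sum_mono[OF f' g' order_trans[OF abs_ge_self bound]])
  moreover have "- (kappa - (Z 2 + Z 3 + Z 5 - Z 6 + Z 7) - sum f F) \<le> 1 / 10000 * (Z 7 - sum g F)"
    by (rule has_sum_mono[OF has_sum_uminusI[OF f'] g' order_trans[OF abs_ge_minus_self bound]])
  ultimately show ?thesis unfolding f_def g_def F_def by (simp only: abs_le_iff)
qed

lemma kappa_bounds: "0.75536661083 \<le> kappa \<and> kappa < 0.75536661084"
proof -
  have z2: "zeta_ln_sum 2 / zeta_sum 2 \<in> {0.569960993094527..0.569960993094541}"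
    by (rule interval_divide[OF zeta_ln_sum_2_bounds zeta_sum_2_bounds]) simp_all
  have z3: "zeta_ln_sum 3 / zeta_sum 3 \<in> {0.164822682158275..0.164822682158281}"
    by (rule interval_divide[OF zeta_ln_sum_3_bounds zeta_sum_3_bounds]) simp_all
  have z5: "zeta_ln_sum 5 / zeta_sum 5 \<in> {0.027556192191528..0.027556192191533}"
    by (rule interval_divide[OF zeta_ln_sum_5_bounds zeta_sum_5_bounds]) simp_all
  have z6: "zeta_ln_sum 6 / zeta_sum 6 \<in> {0.012633069032509..0.012633069032513}"
    by (rule interval_divide[OF zeta_ln_sum_6_bounds zeta_sum_6_bounds]) simp_all
  have z7: "zeta_ln_sum 7 / zeta_sum 7 \<in> {0.005983558570636..0.005983558570640}"
    by (rule interval_divide[OF zeta_ln_sum_7_bounds zeta_sum_7_bounds]) simp_all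
  have f: "(\<Sum>p\<in>{p. prime p \<and> p < 30}. ln (real p) * kappa_weight (real p))
      \<in> {-0.00032374615079..-0.00032374615076}"
    unfolding atLeastAtMost_iff primes_less_30 using ln_prime_lower ln_prime_upper
    by (intro conjI) (simp_all add: kappa_weight_def)
  \<comment> \<open>A lower bound suffices, since this sum enters the error with a minus sign; the
    tail of Z(7) is then below 2.3 * 10^(-10).\<close>
  have g: "(\<Sum>p\<in>{p. prime p \<and> p < 30}. ln (real p) / (real p ^ 7 - 1)) \<ge> 0.005983558348"
    unfolding primes_less_30 using ln_prime_lower ln_prime_upper by simp
  \<comment> \<open>The combined uncertainty is below 10^(-12), and the centre, about
    0.7553666108317, is farther than that from both endpoints.\<close>
  show ?thesis using kappa_decomposition z2 z3 z5 z6 z7 f g unfolding atLeastAtMost_iff abs_le_iff by simp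
qed

theorem theorem6p4:
  shows "(\<forall>(m::nat) (l::nat). m \<ge> 2 \<longrightarrow> real l \<ge> s_fun m * exp (s_fun m) \<longrightarrow>
            real (D m l) \<ge> exp (kappa_m m * real m * real l))
       \<and> (\<forall>m::nat. m \<ge> 2 \<longrightarrow>
            kappa_m m \<ge> w_fun ((real m + 1) / 2) (s_fun m * exp (s_fun m)) * (1 / real m) *
              (\<Sum>p\<in>small_primes m. (real ((m + 1) div p) - 1) * (ln (real p) / (real p - 1))))
       \<and> (kappa_m \<longlonglongrightarrow> kappa)
       \<and> (\<lambda>p::nat. ln (real p) / (real p * (real p - 1))) summable_on {p. prime p}
       \<and> 0.75536661083 \<le> kappa \<and> kappa < 0.75536661084"
  using D_ge_exp_kappa_m kappa_m_lower kappa_m_tendsto kappa_bounds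
    kappa_term_summable_on[of "{p. prime p}"]
  by (auto simp: kappa_term_def[abs_def])

end
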